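(* Let $X$ be a zero-dimensional space and let $L$ be a generalized ordered space belonging to the class $\mathcal L$. If $f:X\to L$ is a continuous bijection, then there exist a zero-dimensional generalized ordered space $M$ whose weight is at most the weight of $L$, and continuous bijections $g:X\to M$ and $h:M\to L$ such that $f=h\circ g$.
   Context: All spaces are assumed Tychonoff. A space is called zero-dimensional if its small inductive dimension $\mathrm{ind}$ equals $0$ (i.e. it is non-empty and has a base consisting of clopen sets). A linearly ordered space (LOTS) is a space whose topology is the one induced by some linear order. A generalized ordered space (GO-space) is a subspace of a LOTS; equivalently, a Hausdorff space whose topology can be generated by a collection of sets that are convex with respect to some linear order on it. The class $\mathcal L$ is defined as follows: a GO-space $L$ is in $\mathcal L$ if and only if $L$ has a dense subset which is a countable union of subspaces each of which is discrete in itself; equivalently, if and only if $L$ has a $\sigma$-disjoint $\pi$-base. Here a $\pi$-base of a space $Z$ is a collection $\mathcal U$ of non-empty open subsets of $Z$ such that every non-empty open set $O\subset Z$ contains some $U\in\mathcal U$; it is $\sigma$-disjoint if it is a countable union of families each consisting of pairwise disjoint sets. The weight of a space is the minimal cardinality of a base of its topology. *)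

theory Defs
  imports "HOL-Analysis.Analysis"
begin

unbundle cardinal_syntax

definition tychonoff_space :: "'a topology \<Rightarrow> bool" where
  "tychonoff_space X \<longleftrightarrow> t1_space X \<and> completely_regular_space X"

(* dim_le is the library's small inductive dimension, with the empty space as the only
   space of dimension at most -1; so this says ind X = 0. *)
definition zero_dimensional_space :: "'a topology \<Rightarrow> bool" where
  "zero_dimensional_space X \<longleftrightarrow> X dim_le 0 \<and> \<not> X dim_le -1"

lemma zero_dimensional_space_iff_clopen_base:
  "zero_dimensional_space X \<longleftrightarrow>
     topspace X \<noteq> {} \<and>
     (\<exists>B. (\<forall>U\<in>B. openin X U \<and> closedin X U) \<and> openin X = arbitrary union_of (\<lambda>U. U \<in> B))"
  (is "_ \<longleftrightarrow> _ \<and> ?base")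
proof -
  have "X dim_le 0 \<longleftrightarrow> ?base"
  proof
    assume "X dim_le 0"
    then have nb: "neighbourhood_base_of (\<lambda>U. closedin X U \<and> openin X U) X"
      by (simp add: dimension_le_0_neighbourhood_base_of_clopen)
    let ?B = "{U. openin X U \<and> closedin X U}"
    have "\<exists>V. V \<in> ?B \<and> x \<in> V \<and> V \<subseteq> W" if W: "openin X W" "x \<in> W" for W x
    proof -
      have "\<exists>U V. openin X U \<and> (closedin X V \<and> openin X V) \<and> x \<in> U \<and> U \<subseteq> V \<and> V \<subseteq> W"
        using nb[unfolded neighbourhood_base_of, rule_format] W by simp
      then show ?thesis
        by auto
    qed
    then have "openin X = arbitrary union_of (\<lambda>U. U \<in> ?B)"
      by (simp add: openin_topology_base_unique)
    moreover have "\<forall>U\<in>?B. openin X U \<and> closedin X U"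
      by simp
    ultimately show ?base
      by (intro exI[of _ ?B] conjI)
  next
    assume ?base
    then obtain B where clopen: "\<forall>U\<in>B. openin X U \<and> closedin X U"
      and B: "openin X = arbitrary union_of (\<lambda>U. U \<in> B)"
      by blast
    show "X dim_le 0"
      unfolding dimension_le_0_neighbourhood_base_of_clopen neighbourhood_base_of
    proof (intro allI impI)
      fix W x assume "openin X W \<and> x \<in> W"
      then obtain U where "U \<in> B" "x \<in> U" "U \<subseteq> W"
        using iffD1[OF openin_topology_base_unique B] by metis
      then show "\<exists>U V. openin X U \<and> (closedin X V \<and> openin X V) \<and> x \<in> U \<and> U \<subseteq> V \<and> V \<subseteq> W"
        using clopen by blast
    qed
  qed
  then show ?thesis
    unfolding zero_dimensional_space_def by (auto simp flip: null_topspace_iff_trivial)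
qed

definition order_convex :: "'a rel \<Rightarrow> 'a set \<Rightarrow> bool" where
  "order_convex r C \<longleftrightarrow> (\<forall>x\<in>C. \<forall>z\<in>C. \<forall>y. (x, y) \<in> r \<and> (y, z) \<in> r \<longrightarrow> y \<in> C)"

(* The intrinsic description of subspaces of linearly ordered spaces; it avoids quantifying
   over the type of the ambient ordered space. *)
definition GO_space :: "'a topology \<Rightarrow> bool" where
  "GO_space X \<longleftrightarrow> Hausdorff_space X \<and>
     (\<exists>r \<B>. linear_order_on (topspace X) r \<and> (\<forall>C\<in>\<B>. order_convex r C) \<and>
            X = topology_generated_by \<B>)"

definition class_L :: "'a topology \<Rightarrow> bool" where
  "class_L X \<longleftrightarrow> GO_space X \<and>
     (\<exists>\<D>. countable \<D> \<and> (\<forall>D\<in>\<D>. subtopology X D = discrete_topology D) \<and>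
          X closure_of (\<Union>\<D>) = topspace X)"

definition is_base :: "'a topology \<Rightarrow> 'a set set \<Rightarrow> bool" where
  "is_base X B \<longleftrightarrow> openin X = arbitrary union_of (\<lambda>U. U \<in> B)"

(* A cardinal in the sense of the HOL cardinal library, to be compared using \<le>o;
   the lemma below shows that the choice is well defined. *)
definition weight :: "'a topology \<Rightarrow> 'a set rel" where
  "weight X = (SOME \<kappa>. \<exists>B. is_base X B \<and> \<kappa> = |B| \<and> (\<forall>B'. is_base X B' \<longrightarrow> |B| \<le>o |B'| ))"

lemma weight_base:
  obtains B where "is_base X B" "weight X = |B|" "\<And>B'. is_base X B' \<Longrightarrow> weight X \<le>o |B'|"
proof -
  let ?R = "{|B| | B. is_base X B}"
  have "is_base X {U. openin X U}"
    unfolding is_base_def openin_topology_base_unique by auto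
  then have "?R \<noteq> {}"
    by blast
  moreover have "\<forall>r\<in>?R. Card_order r"
    using card_of_Card_order by blast
  ultimately obtain r where "r \<in> ?R" "\<forall>r'\<in>?R. r \<le>o r'"
    using exists_minim_Card_order[of ?R] by blast
  then have "\<exists>\<kappa> B. is_base X B \<and> \<kappa> = |B| \<and> (\<forall>B'. is_base X B' \<longrightarrow> |B| \<le>o |B'| )"
    by blast
  then have "\<exists>B. is_base X B \<and> weight X = |B| \<and> (\<forall>B'. is_base X B' \<longrightarrow> |B| \<le>o |B'| )"
    unfolding weight_def by (rule someI_ex)
  then show ?thesis
    using that by auto
qed

definition continuous_bijection :: "'a topology \<Rightarrow> 'b topology \<Rightarrow> ('a \<Rightarrow> 'b) \<Rightarrow> bool" where
  "continuous_bijection X Y f \<longleftrightarrow>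
     continuous_map X Y f \<and> bij_betw f (topspace X) (topspace Y)"

end

theory Submission
  imports Defs
begin

text \<open>
  Identify the points of \<open>X\<close> with those of \<open>L\<close> through \<open>f\<close>, so that the topology of \<open>X\<close> is finer than that
  of \<open>L\<close>; the space \<open>M\<close> is sought between the two, with \<open>g = f\<close> and \<open>h\<close> the identity.

  The source of clopen sets is the following remark (\<open>clopen_cut\<close>). If \<open>V\<close> is open and convex in \<open>L\<close>,
  \<open>q \<in> V\<close>, and \<open>N\<close> is a clopen neighbourhood of \<open>q\<close> in \<open>X\<close> inside \<open>V\<close>, then
  \<open>S = N \<union> {y. q < y}\<close> is clopen in \<open>X\<close>, because its complement is \<open>{y. y < q} - N\<close>. Thus every \<open>V\<close>
  carries a set clopen in \<open>X\<close> that is a final segment of \<open>L\<close> except for an arbitrary behaviour inside \<open>V\<close>,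
  and the sets that belong to pairwise disjoint \<open>V\<close> form a chain.

  Let level \<open>0\<close> be the chain of the clopen final segments of \<open>L\<close>. Points that it does not separate span
  an interval that is densely ordered and has no isolated points. The dense \<open>\<sigma>\<close>-discrete set is used to
  build an increasing sequence of closed barriers, nowhere dense in such intervals. The cells of stage \<open>n\<close>
  are the largest open convex sets that avoid the \<open>n\<close>-th barrier and that no clopen final segment cuts. The
  cells of one stage are disjoint, and those of all stages together are fine enough that some cell lies
  between any two points that level \<open>0\<close> does not separate (\<open>cell_between\<close>).
  Level \<open>n + 1\<close> is the chain of the sets \<open>S\<close> of the cells \<open>V\<close> of stage \<open>n\<close>.

  Let \<open>M\<close> be generated by the open sets of \<open>L\<close> together with all these sets \<open>S\<close> and their complements. All
  of them are open in \<open>X\<close>. The members of the levels are clopen in \<open>M\<close>, and an open convex set of \<open>L\<close>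
  contains, around each of its points, the difference of two of them; so \<open>M\<close> has a clopen base. Disjointness
  of the cells of one stage bounds the number of new generators by the weight of \<open>L\<close> when this is
  infinite; when it is finite, \<open>L\<close> is discrete and \<open>M = L\<close> does.

  It remains to see that \<open>M\<close> is a GO-space, for a new order: the lexicographic order of the sequence of
  levels. A point \<open>x\<close> whose lexicographic classes all are neighbourhoods of \<open>x\<close> causes no difficulty.
  Otherwise there is, say on the lower side, a first level at which the class of \<open>x\<close> fails to contain all
  points that are close to \<open>x\<close> and below it. Then \<open>x\<close> is a limit from the left, in the old order, of a
  chain of cuts of this level. Cells are not cut by level \<open>0\<close>, and a point chosen in each cell is put into the
  next barrier; therefore no cell used after this level contains \<open>x\<close>, and all later levels treat \<open>x\<close> like an unperturbed cut between the smaller and the larger points (\<open>breaking_level\<close>).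
  Hence near \<open>x\<close> the new order agrees with the old one as far as is needed for convex neighbourhoods
  (\<open>captures_below_generator\<close>). The upper side follows by reversing the order and complementing every \<open>S\<close>.
\<close>

section \<open>Linear orders and convex sets\<close>

text \<open>A strict linear order on a carrier set \<open>K\<close>; it relates only elements of \<open>K\<close>.\<close>

locale strict_linear =
  fixes K :: "'a set" and lt :: "'a \<Rightarrow> 'a \<Rightarrow> bool" (infix "\<lessdot>" 50)
  assumes lt_carrier: "x \<lessdot> y \<Longrightarrow> x \<in> K \<and> y \<in> K"
    and lt_irrefl: "\<not> x \<lessdot> x"
    and lt_trans: "x \<lessdot> y \<Longrightarrow> y \<lessdot> z \<Longrightarrow> x \<lessdot> z"
    and lt_linear: "x \<in> K \<Longrightarrow> y \<in> K \<Longrightarrow> x = y \<or> x \<lessdot> y \<or> y \<lessdot> x"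
begin

lemma lt_asym: "x \<lessdot> y \<Longrightarrow> \<not> y \<lessdot> x"
  using lt_irrefl lt_trans by blast

definition convex_in :: "'a set \<Rightarrow> bool" where
  "convex_in C \<longleftrightarrow> (\<forall>x\<in>C. \<forall>z\<in>C. \<forall>y. x \<lessdot> y \<and> y \<lessdot> z \<longrightarrow> y \<in> C)"

lemma convex_inD: "convex_in C \<Longrightarrow> x \<in> C \<Longrightarrow> z \<in> C \<Longrightarrow> x \<lessdot> y \<Longrightarrow> y \<lessdot> z \<Longrightarrow> y \<in> C"
  unfolding convex_in_def by blast

lemma convex_side:
  assumes "convex_in U" "U \<subseteq> K" "x \<in> K" "x \<notin> U"
  shows "(\<forall>v\<in>U. v \<lessdot> x) \<or> (\<forall>v\<in>U. x \<lessdot> v)"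
proof (rule ccontr)
  assume "\<not> ?thesis"
  then obtain v w where "v \<in> U" "\<not> v \<lessdot> x" "w \<in> U" "\<not> x \<lessdot> w"
    by blast
  then have "x \<lessdot> v" "w \<lessdot> x"
    using assms lt_linear by (metis subsetD)+
  then show False
    using convex_inD[OF assms(1), of w v x] \<open>v \<in> U\<close> \<open>w \<in> U\<close> assms(4) by blast
qed

lemma convex_disjoint_cases:
  assumes "convex_in V" "convex_in W" "V \<subseteq> K" "W \<subseteq> K" "V \<inter> W = {}"
  shows "(\<forall>v\<in>V. \<forall>w\<in>W. v \<lessdot> w) \<or> (\<forall>v\<in>V. \<forall>w\<in>W. w \<lessdot> v)"
proof (rule ccontr)
  assume contr: "\<not> ?thesis"
  obtain v w where "v \<in> V" "w \<in> W" "\<not> v \<lessdot> w"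
    using contr by blast
  moreover obtain v' w' where "v' \<in> V" "w' \<in> W" "\<not> w' \<lessdot> v'"
    using contr by blast
  ultimately have *: "v \<in> V" "w \<in> W" "w \<lessdot> v" "v' \<in> V" "w' \<in> W" "v' \<lessdot> w'"
    using assms(3-5) lt_linear by (metis disjoint_iff subsetD)+
  have "\<forall>v\<in>V. w \<lessdot> v"
    using convex_side[of V w] assms * lt_asym by blast
  then have "w \<lessdot> v'" using * by blast
  then have "v' \<in> W"
    using convex_inD[OF assms(2)] * by blast
  then show False using * assms(5) by blast
qed

text \<open>The points of the carrier lying strictly above all of \<open>V\<close>.\<close>

definition above :: "'a set \<Rightarrow> 'a set" where
  "above V = {y \<in> K. \<forall>v\<in>V. v \<lessdot> y}"

end

context strict_linear
begin

lemma dual_strict_linear: "strict_linear K (\<lambda>x y. y \<lessdot> x)"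
  using lt_carrier lt_irrefl lt_trans lt_linear by unfold_locales blast+

lemma dual_convex_in: "strict_linear.convex_in (\<lambda>x y. y \<lessdot> x) C \<longleftrightarrow> convex_in C"
  unfolding convex_in_def strict_linear.convex_in_def[OF dual_strict_linear] by blast

end

section \<open>Lexicographic orders of sequences of chains\<close>

text \<open>\<open>agree \<S> n x y\<close> says that no member of the first \<open>n\<close> families separates \<open>x\<close> from \<open>y\<close>. In the
  lexicographic order the first family that has a member containing exactly one of two points decides, and
  the point outside that member is the smaller one.\<close>

definition agree :: "(nat \<Rightarrow> 'a set set) \<Rightarrow> nat \<Rightarrow> 'a \<Rightarrow> 'a \<Rightarrow> bool" where
  "agree \<S> n x y \<longleftrightarrow> (\<forall>m<n. \<forall>S\<in>\<S> m. x \<in> S \<longleftrightarrow> y \<in> S)"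

definition lex_less :: "'a set \<Rightarrow> (nat \<Rightarrow> 'a set set) \<Rightarrow> 'a \<Rightarrow> 'a \<Rightarrow> bool" where
  "lex_less K \<S> x y \<longleftrightarrow> x \<in> K \<and> y \<in> K \<and> (\<exists>n. agree \<S> n x y \<and> (\<exists>S\<in>\<S> n. x \<notin> S \<and> y \<in> S))"

lemma agree_sym: "agree \<S> n x y \<Longrightarrow> agree \<S> n y x"
  unfolding agree_def by blast

lemma agree_trans: "agree \<S> n x y \<Longrightarrow> agree \<S> n y z \<Longrightarrow> agree \<S> n x z"
  unfolding agree_def by blast

lemma agree_mono: "agree \<S> n x y \<Longrightarrow> m \<le> n \<Longrightarrow> agree \<S> m x y"
  unfolding agree_def by (meson order.strict_trans2)

lemma agree_Suc: "agree \<S> (Suc n) x y \<longleftrightarrow> agree \<S> n x y \<and> (\<forall>S\<in>\<S> n. x \<in> S \<longleftrightarrow> y \<in> S)"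
  unfolding agree_def by (auto simp: less_Suc_eq)

text \<open>Chains of sets that separate points: then the lexicographic order is linear.\<close>

locale chain_sequence =
  fixes K :: "'a set" and \<S> :: "nat \<Rightarrow> 'a set set"
  assumes chain: "S \<in> \<S> n \<Longrightarrow> T \<in> \<S> n \<Longrightarrow> S \<subseteq> T \<or> T \<subseteq> S"
    and separating: "x \<in> K \<Longrightarrow> y \<in> K \<Longrightarrow> x \<noteq> y \<Longrightarrow> \<exists>n. \<exists>S\<in>\<S> n. x \<in> S \<longleftrightarrow> y \<notin> S"
begin

lemma lex_less_mono:
  assumes "lex_less K \<S> x y" "agree \<S> n x y" "S \<in> \<S> n" "x \<in> S"
  shows "y \<in> S"
proof -
  obtain k T where k: "agree \<S> k x y" "T \<in> \<S> k" "x \<notin> T" "y \<in> T"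
    using assms(1) unfolding lex_less_def by blast
  have "n \<le> k"
    using k assms(2) unfolding agree_def by (meson not_le)
  moreover have "n = k \<Longrightarrow> y \<in> S"
    using chain[of S n T] k assms by blast
  moreover have "n < k \<Longrightarrow> y \<in> S"
    using k(1) assms unfolding agree_def by blast
  ultimately show ?thesis by linarith
qed

text \<open>The classes of points that agree on the first \<open>n\<close> families are convex.\<close>

lemma lex_less_between:
  assumes "lex_less K \<S> x y" "lex_less K \<S> y z" "agree \<S> n x z"
  shows "agree \<S> n x y"
  using assms(3)
proof (induction n)
  case (Suc n)
  then have xz: "agree \<S> n x z" "\<forall>S\<in>\<S> n. x \<in> S \<longleftrightarrow> z \<in> S" and xy: "agree \<S> n x y"
    by (simp_all add: agree_Suc)
  have yz: "agree \<S> n y z"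
    by (rule agree_trans[OF agree_sym[OF xy] xz(1)])
  show ?case
    using lex_less_mono[OF assms(1) xy] lex_less_mono[OF assms(2) yz] xy xz(2)
    unfolding agree_Suc by blast
qed (simp add: agree_def)

lemma lex_less_irrefl: "\<not> lex_less K \<S> x x"
  unfolding lex_less_def by blast

lemma lex_less_linear:
  assumes "x \<in> K" "y \<in> K" "x \<noteq> y"
  shows "lex_less K \<S> x y \<or> lex_less K \<S> y x"
proof -
  let ?P = "\<lambda>n. \<exists>S\<in>\<S> n. x \<in> S \<longleftrightarrow> y \<notin> S"
  have "?P (LEAST n. ?P n)"
    by (rule LeastI_ex[of ?P, OF separating[OF assms]])
  moreover have ag: "agree \<S> (LEAST n. ?P n) x y"
    unfolding agree_def using not_less_Least[of _ ?P] by blast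
  moreover note agree_sym[OF ag]
  ultimately show ?thesis
    using assms unfolding lex_less_def by blast
qed

lemma lex_less_trans:
  assumes "lex_less K \<S> x y" "lex_less K \<S> y z"
  shows "lex_less K \<S> x z"
proof -
  obtain k S where k: "agree \<S> k x y" "S \<in> \<S> k" "x \<notin> S" "y \<in> S"
    using assms(1) unfolding lex_less_def by blast
  obtain l T where l: "agree \<S> l y z" "T \<in> \<S> l" "y \<notin> T" "z \<in> T"
    using assms(2) unfolding lex_less_def by blast
  have ag: "agree \<S> (min k l) x z"
    by (rule agree_trans[OF agree_mono[OF k(1)] agree_mono[OF l(1)]]) simp_all
  have "\<exists>S\<in>\<S> (min k l). x \<notin> S \<and> z \<in> S"
  proof (cases "k \<le> l")
    case True
    then have "z \<in> S"
      using lex_less_mono[OF assms(2) agree_mono[OF l(1)]] k by blast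
    then show ?thesis using True k by (auto simp: min_def)
  next
    case False
    then have "x \<notin> T"
      using lex_less_mono[OF assms(1) agree_mono[OF k(1)], of l T] l by auto
    then show ?thesis using False l by (auto simp: min_def)
  qed
  then show ?thesis
    using ag assms unfolding lex_less_def by blast
qed

lemma strict_linear_lex_less: "strict_linear K (lex_less K \<S>)"
proof
  show "lex_less K \<S> x y \<Longrightarrow> x \<in> K \<and> y \<in> K" for x y
    unfolding lex_less_def by blast
qed (use lex_less_irrefl lex_less_trans lex_less_linear in blast)+

end

text \<open>Complementing all members reverses the lexicographic order.\<close>

lemma lex_less_complement:
  assumes "\<And>n S. S \<in> \<S> n \<Longrightarrow> S \<subseteq> K"
  shows "lex_less K (\<lambda>n. (\<lambda>S. K - S) ` \<S> n) x y \<longleftrightarrow> lex_less K \<S> y x"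
proof (cases "x \<in> K \<and> y \<in> K")
  case True
  then have "agree (\<lambda>n. (\<lambda>S. K - S) ` \<S> n) n x y \<longleftrightarrow> agree \<S> n y x" for n
    unfolding agree_def by auto
  then show ?thesis
    using True unfolding lex_less_def by auto
qed (auto simp: lex_less_def)

section \<open>Generalized order topologies\<close>

text \<open>Convex neighbourhoods are assembled from two one-sided halves: \<open>G\<close> captures \<open>x\<close> from below
  if \<open>G\<close> contains the whole closed interval from \<open>y\<close> to \<open>x\<close> for all \<open>y \<le> x\<close> in some neighbourhood of \<open>x\<close>.
  Capturing from above is the same notion for the reversed order.\<close>

definition captures_below :: "'a topology \<Rightarrow> ('a \<Rightarrow> 'a \<Rightarrow> bool) \<Rightarrow> 'a set \<Rightarrow> 'a \<Rightarrow> bool" where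
  "captures_below M lt G x \<longleftrightarrow>
     (\<exists>N. openin M N \<and> x \<in> N \<and>
          (\<forall>y\<in>N. \<forall>z. (z = y \<or> lt y z) \<and> (z = x \<or> lt z x) \<longrightarrow> z \<in> G))"

lemma captures_belowI:
  assumes "openin M N" "x \<in> N" "x \<in> G"
    "\<And>y z. y \<in> N \<Longrightarrow> z = y \<or> lt y z \<Longrightarrow> lt z x \<Longrightarrow> z \<in> G"
  shows "captures_below M lt G x"
  using assms unfolding captures_below_def by blast

lemma captures_below_mono:
  "captures_below M lt G x \<Longrightarrow> G \<subseteq> H \<Longrightarrow> captures_below M lt H x"
  unfolding captures_below_def by blast

lemma captures_below_Int:
  assumes "captures_below M lt G x" "captures_below M lt H x"
  shows "captures_below M lt (G \<inter> H) x"
proof -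
  obtain A B where
    "openin M A" "x \<in> A" "\<forall>y\<in>A. \<forall>z. (z = y \<or> lt y z) \<and> (z = x \<or> lt z x) \<longrightarrow> z \<in> G"
    "openin M B" "x \<in> B" "\<forall>y\<in>B. \<forall>z. (z = y \<or> lt y z) \<and> (z = x \<or> lt z x) \<longrightarrow> z \<in> H"
    using assms unfolding captures_below_def by auto
  then show ?thesis
    unfolding captures_below_def by (intro exI[of _ "A \<inter> B"]) (auto simp: openin_Int)
qed

lemma captures_below_generated:
  assumes "\<And>G x. G \<in> \<G> \<Longrightarrow> x \<in> G \<Longrightarrow> captures_below M lt G x"
    and "generate_topology_on \<G> G" "x \<in> G"
  shows "captures_below M lt G x"
  using assms(2,3)
proof (induction G arbitrary: x)
  case (Int a b)
  then show ?case by (simp add: captures_below_Int)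
next
  case (UN \<K>)
  then obtain k where "k \<in> \<K>" "x \<in> k"
    by blast
  then show ?case
    using UN.IH[of k x] captures_below_mono[of M lt k x "\<Union>\<K>"] by blast
next
  case (Basis s)
  then show ?case by (rule assms(1))
qed simp

text \<open>The form in which a GO-space \<open>L\<close> with carrier \<open>K\<close> is used: open rays are open, and every point has
  a neighbourhood base of open convex sets.\<close>

locale ordered_topology = strict_linear K lt for K :: "'a set" and lt (infix "\<lessdot>" 50) +
  fixes L :: "'a topology"
  assumes topspace_L: "topspace L = K"
    and open_above: "openin L {y. x \<lessdot> y}"
    and open_below: "openin L {y. y \<lessdot> x}"
    and convex_base: "openin L G \<Longrightarrow> x \<in> G \<Longrightarrow> \<exists>C. openin L C \<and> x \<in> C \<and> C \<subseteq> G \<and> convex_in C"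
begin

lemma open_subset: "openin L G \<Longrightarrow> G \<subseteq> K"
  using openin_subset topspace_L by blast

lemma open_interval: "openin L {z. x \<lessdot> z \<and> z \<lessdot> y}"
  using openin_Int[OF open_above open_below, of x y] by (simp add: Int_def)

text \<open>The clopen final segments.\<close>

definition upper_cuts :: "'a set set" where
  "upper_cuts = {T. openin L T \<and> openin L (K - T) \<and> (\<forall>x\<in>T. \<forall>y. x \<lessdot> y \<longrightarrow> y \<in> T)}"

lemma upper_cuts_chain:
  assumes "S \<in> upper_cuts" "T \<in> upper_cuts"
  shows "S \<subseteq> T \<or> T \<subseteq> S"
proof (rule ccontr)
  assume "\<not> ?thesis"
  then obtain s t where "s \<in> S" "s \<notin> T" "t \<in> T" "t \<notin> S"
    by blast
  moreover have "S \<subseteq> K" "T \<subseteq> K"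
    using assms open_subset unfolding upper_cuts_def by blast+
  ultimately have "s \<lessdot> t \<or> t \<lessdot> s"
    using lt_linear by (metis subsetD)
  then show False
    using assms \<open>s \<in> S\<close> \<open>s \<notin> T\<close> \<open>t \<in> T\<close> \<open>t \<notin> S\<close> unfolding upper_cuts_def by blast
qed

end

text \<open>A Hausdorff space whose open sets capture their points from both sides is a GO-space.\<close>

lemma GO_space_if_captures:
  fixes M :: "'a topology" and lt (infix "\<lessdot>" 50)
  assumes K: "topspace M = K" and lin: "strict_linear K lt" and haus: "Hausdorff_space M"
    and below: "\<And>G x. openin M G \<Longrightarrow> x \<in> G \<Longrightarrow> captures_below M (\<lessdot>) G x"
    and above: "\<And>G x. openin M G \<Longrightarrow> x \<in> G \<Longrightarrow> captures_below M (\<lambda>x y. y \<lessdot> x) G x"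
  shows "GO_space M"
proof -
  interpret strict_linear K lt by (rule lin)
  have t1: "openin M (K - {x})" for x
    using Hausdorff_imp_t1_space[OF haus] K openin_topspace[of M] unfolding t1_space_openin_delete_alt by blast
  \<comment> \<open>Stated for an arbitrary order in order to serve the upward and the downward rays alike.\<close>
  have ray: "openin M {y. R x y}"
    if R: "strict_linear K R" and cap: "\<And>G y. openin M G \<Longrightarrow> y \<in> G \<Longrightarrow> captures_below M R G y" for R x
  proof (subst openin_subopen, intro ballI)
    interpret R: strict_linear K R by (rule R)
    fix y assume "y \<in> {y. R x y}"
    then have y: "R x y" "x \<in> K" "y \<in> K" "y \<noteq> x"
      using R.lt_carrier R.lt_irrefl by blast+
    then obtain N where N: "openin M N" "y \<in> N"
      "\<forall>y'\<in>N. \<forall>z. (z = y' \<or> R y' z) \<and> (z = y \<or> R z y) \<longrightarrow> z \<in> K - {x}"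
      using cap[OF t1, of y x] unfolding captures_below_def by blast
    have "R x y'" if "y' \<in> N" for y'
    proof -
      have "\<not> (x = y' \<or> R y' x)"
        using N(3) that y(1) by blast
      moreover have "y' \<in> K"
        using N(1) that openin_subset K by blast
      ultimately show ?thesis
        using R.lt_linear y(2) by blast
    qed
    then show "\<exists>T. openin M T \<and> y \<in> T \<and> T \<subseteq> {y. R x y}"
      using N by blast
  qed
  have ray_above: "openin M {y. x \<lessdot> y}" for x
    by (rule ray[OF lin below])
  have ray_below: "openin M {y. y \<lessdot> x}" for x
    by (rule ray[OF dual_strict_linear above])
  define r where "r = {(x, y). x \<in> K \<and> y \<in> K \<and> (x = y \<or> x \<lessdot> y)}"
  have r: "linear_order_on (topspace M) r"
  proof -
    have "r \<subseteq> K \<times> K" "refl_on K r" "total_on K r"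
      using lt_linear unfolding refl_on_def total_on_def r_def by auto
    moreover have "trans r"
    proof (rule transI)
      fix x y z assume "(x, y) \<in> r" "(y, z) \<in> r"
      then show "(x, z) \<in> r"
        using lt_trans[of x y z] unfolding r_def by auto
    qed
    moreover have "antisym r"
    proof (rule antisymI)
      fix x y assume "(x, y) \<in> r" "(y, x) \<in> r"
      then show "x = y"
        using lt_asym[of x y] unfolding r_def by auto
    qed
    ultimately show ?thesis
      unfolding linear_order_on_def partial_order_on_def preorder_on_def K by blast
  qed
  define \<B> where "\<B> = {C. openin M C \<and> order_convex r C}"
  have base: "\<exists>C\<in>\<B>. x \<in> C \<and> C \<subseteq> G" if G: "openin M G" "x \<in> G" for G x
  proof -
    obtain N1 where N1: "openin M N1" "x \<in> N1"
      "\<forall>y\<in>N1. \<forall>z. (z = y \<or> y \<lessdot> z) \<and> (z = x \<or> z \<lessdot> x) \<longrightarrow> z \<in> G"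
      using below[OF G] unfolding captures_below_def by blast
    obtain N2 where N2: "openin M N2" "x \<in> N2"
      "\<forall>y\<in>N2. \<forall>z. (z = y \<or> z \<lessdot> y) \<and> (z = x \<or> x \<lessdot> z) \<longrightarrow> z \<in> G"
      using above[OF G] unfolding captures_below_def by blast
    define W where "W = {z. \<exists>y\<in>N1. (z = y \<or> y \<lessdot> z) \<and> (z = x \<or> z \<lessdot> x)} \<union>
                        {z. \<exists>y\<in>N2. (z = y \<or> z \<lessdot> y) \<and> (z = x \<or> x \<lessdot> z)}"
    have WG: "W \<subseteq> G"
      using N1(3) N2(3) unfolding W_def by blast
    have xK: "x \<in> K" and NK: "N1 \<subseteq> K"
      using G(1,2) N1(1) openin_subset K by blast+
    have NW: "N1 \<inter> N2 \<subseteq> W"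
      using lt_linear[OF xK] NK unfolding W_def by blast
    have Wconv: "c \<in> W" if ab: "a \<in> W" "b \<in> W" "a \<lessdot> c" "c \<lessdot> b" for a b c
    proof -
      have "c \<in> K" using ab lt_carrier by blast
      then consider "c = x" | "c \<lessdot> x" | "x \<lessdot> c"
        using lt_linear[OF xK] by blast
      then show ?thesis
      proof cases
        case 1
        then show ?thesis using N1(2) unfolding W_def by blast
      next
        case 2
        then have "a \<lessdot> x" using ab lt_trans by blast
        then obtain y where "y \<in> N1" "a = y \<or> y \<lessdot> a"
          using ab(1) lt_asym lt_irrefl unfolding W_def by blast
        then show ?thesis using 2 ab(3) lt_trans unfolding W_def by blast
      next
        case 3
        then have "x \<lessdot> b" using ab lt_trans by blast
        then obtain y where "y \<in> N2" "b = y \<or> b \<lessdot> y"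
          using ab(2) lt_asym lt_irrefl unfolding W_def by blast
        then show ?thesis using 3 ab(4) lt_trans unfolding W_def by blast
      qed
    qed
    \<comment> \<open>\<open>W\<close> is a convex neighbourhood of \<open>x\<close>; since open intervals are open in \<open>M\<close>, its interior is convex too.\<close>
    define C where "C = M interior_of W"
    have C: "openin M C" "x \<in> C" "C \<subseteq> W"
      using interior_of_maximal[OF NW] N1 N2 unfolding C_def
      by (auto simp: interior_of_subset openin_Int)
    have "order_convex r C"
      unfolding order_convex_def
    proof (intro ballI allI impI)
      fix a b c assume a: "a \<in> C" and b: "b \<in> C" and "(a, c) \<in> r \<and> (c, b) \<in> r"
      then consider "c = a \<or> c = b" | "a \<lessdot> c" "c \<lessdot> b"
        unfolding r_def by blast
      then show "c \<in> C"
      proof cases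
        case 2
        have "openin M ({z. a \<lessdot> z} \<inter> {z. z \<lessdot> b})"
          using ray_above ray_below by blast
        moreover have "{z. a \<lessdot> z} \<inter> {z. z \<lessdot> b} \<subseteq> W"
          using Wconv a b C(3) by blast
        ultimately show ?thesis
          using 2 interior_of_maximal unfolding C_def by blast
      qed (use a b in blast)
    qed
    then show ?thesis
      using C WG unfolding \<B>_def by blast
  qed
  have "M = topology_generated_by \<B>"
  proof (rule topology_eq[THEN iffD2], intro allI iffI)
    fix G assume "openin M G"
    then have "\<exists>C. openin (topology_generated_by \<B>) C \<and> x \<in> C \<and> C \<subseteq> G" if "x \<in> G" for x
      using base[of G x] that topology_generated_by_Basis[of _ \<B>] by blast
    then show "openin (topology_generated_by \<B>) G"
      by (subst openin_subopen) blast
  next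
    fix G assume "openin (topology_generated_by \<B>) G"
    then have gen: "generate_topology_on \<B> G"
      by (rule openin_topology_generated_by)
    show "openin M G"
      by (rule generate_topology_on_coarsest[OF istopology_openin _ gen]) (simp add: \<B>_def)
  qed
  then show ?thesis
    using haus r unfolding GO_space_def
    by (intro conjI exI[of _ r] exI[of _ \<B>]) (auto simp: \<B>_def)
qed

text \<open>In a Hausdorff topology generated by convex sets the open rays are automatically open.\<close>

lemma GO_space_imp_ordered_topology:
  assumes "GO_space L"
  obtains lt where "ordered_topology (topspace L) lt L"
proof -
  obtain r \<B> where r: "linear_order_on (topspace L) r" and conv: "\<forall>C\<in>\<B>. order_convex r C"
    and L: "L = topology_generated_by \<B>" and haus: "Hausdorff_space L"
    using assms unfolding GO_space_def by blast
  define lt where "lt x y \<longleftrightarrow> (x, y) \<in> r \<and> x \<noteq> y" for x y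
  have r': "r \<subseteq> topspace L \<times> topspace L" "refl_on (topspace L) r" "trans r" "antisym r" "total_on (topspace L) r"
    using r unfolding linear_order_on_def partial_order_on_def preorder_on_def by simp_all
  interpret strict_linear "topspace L" lt
  proof
    show "x \<in> topspace L \<and> y \<in> topspace L" if "lt x y" for x y
      using that r'(1) unfolding lt_def by blast
    show "\<not> lt x x" for x
      unfolding lt_def by simp
    show "lt x z" if "lt x y" "lt y z" for x y z
      using that transD[OF r'(3), of x y z] antisymD[OF r'(4), of x y] unfolding lt_def by auto
    show "x = y \<or> lt x y \<or> lt y x" if "x \<in> topspace L" "y \<in> topspace L" for x y
      using r'(5) that unfolding total_on_def lt_def by auto
  qed
  have convex: "convex_in C" if "order_convex r C" for C
    unfolding convex_in_def
  proof (intro ballI allI impI)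
    fix x z y assume "x \<in> C" "z \<in> C" "lt x y \<and> lt y z"
    then show "y \<in> C"
      using that[unfolded order_convex_def, rule_format, of x z y] unfolding lt_def by blast
  qed
  have convex_Int: "convex_in (C \<inter> D)" if "convex_in C" "convex_in D" for C D
    using that unfolding convex_in_def by blast
  have base: "\<exists>C. openin L C \<and> x \<in> C \<and> C \<subseteq> G \<and> convex_in C" if "openin L G" "x \<in> G" for G x
  proof -
    have "generate_topology_on \<B> G"
      using that(1) unfolding L by (rule openin_topology_generated_by)
    then show ?thesis
      using that(2)
    proof (induction arbitrary: x)
      case (Int A B)
      obtain C where C: "openin L C" "x \<in> C" "C \<subseteq> A" "convex_in C"
        using Int.IH(1)[of x] Int.prems by blast
      obtain D where D: "openin L D" "x \<in> D" "D \<subseteq> B" "convex_in D"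
        using Int.IH(2)[of x] Int.prems by blast
      show ?case
        using C D convex_Int by (intro exI[of _ "C \<inter> D"]) auto
    next
      case (UN \<K>)
      then obtain k where k: "k \<in> \<K>" "x \<in> k"
        by blast
      obtain C where "openin L C" "x \<in> C" "C \<subseteq> k" "convex_in C"
        using UN.IH[OF k] by blast
      then show ?case
        using k(1) by blast
    next
      case (Basis C)
      have "openin L C"
        unfolding L by (rule topology_generated_by_Basis[OF Basis(1)])
      then show ?case
        using Basis convex[of C] conv by blast
    qed simp
  qed
  have separate: "\<exists>C. openin L C \<and> y \<in> C \<and> x \<notin> C \<and> convex_in C"
    if xy: "x \<in> topspace L" "y \<in> topspace L" "x \<noteq> y" for x y
  proof -
    obtain U where U: "openin L U" "y \<in> U" "x \<notin> U"
      using Hausdorff_imp_t1_space[OF haus] xy unfolding t1_space_def by metis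
    then show ?thesis
      using base[OF U(1,2)] by blast
  qed
  have above: "openin L {y. lt x y}" for x
  proof (subst openin_subopen, intro ballI)
    fix y assume "y \<in> {y. lt x y}"
    then have xy: "lt x y" "x \<in> topspace L" "y \<in> topspace L" "x \<noteq> y"
      using lt_carrier lt_irrefl by blast+
    obtain C where C: "openin L C" "y \<in> C" "x \<notin> C" "convex_in C"
      using separate[OF xy(2-4)] by blast
    have "lt x z" if "z \<in> C" for z
      using convex_inD[OF C(4) that C(2) _ xy(1)] C(3) that lt_linear[OF xy(2), of z] openin_subset[OF C(1)]
      by blast
    then show "\<exists>T. openin L T \<and> y \<in> T \<and> T \<subseteq> {y. lt x y}"
      using C by blast
  qed
  have below: "openin L {y. lt y x}" for x
  proof (subst openin_subopen, intro ballI)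
    fix y assume "y \<in> {y. lt y x}"
    then have xy: "lt y x" "x \<in> topspace L" "y \<in> topspace L" "x \<noteq> y"
      using lt_carrier lt_irrefl by blast+
    obtain C where C: "openin L C" "y \<in> C" "x \<notin> C" "convex_in C"
      using separate[OF xy(2-4)] by blast
    have "lt z x" if "z \<in> C" for z
      using convex_inD[OF C(4) C(2) that xy(1)] C(3) that lt_linear[OF xy(2), of z] openin_subset[OF C(1)]
      by blast
    then show "\<exists>T. openin L T \<and> y \<in> T \<and> T \<subseteq> {y. lt y x}"
      using C by blast
  qed
  have "ordered_topology (topspace L) lt L"
    by unfold_locales (simp_all add: above below base)
  then show ?thesis
    by (rule that)
qed

context ordered_topology
begin

lemma dual_ordered_topology: "ordered_topology K (\<lambda>x y. y \<lessdot> x) L"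
proof -
  interpret dual: strict_linear K "\<lambda>x y. y \<lessdot> x"
    by (rule dual_strict_linear)
  show ?thesis
    by unfold_locales (simp_all add: topspace_L open_above open_below convex_base dual_convex_in)
qed

lemma dual_upper_cuts:
  "ordered_topology.upper_cuts K (\<lambda>x y. y \<lessdot> x) L = (\<lambda>T. K - T) ` upper_cuts"
proof -
  interpret dual: ordered_topology K "\<lambda>x y. y \<lessdot> x" L
    by (rule dual_ordered_topology)
  have "T \<in> dual.upper_cuts \<longleftrightarrow> T \<subseteq> K \<and> K - T \<in> upper_cuts" for T
  proof (cases "T \<subseteq> K")
    case True
    then have "K - (K - T) = T" by blast
    then show ?thesis
      using True lt_carrier unfolding dual.upper_cuts_def upper_cuts_def by auto
  next
    case False
    then show ?thesis
      using open_subset unfolding dual.upper_cuts_def by blast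
  qed
  moreover have "T \<in> upper_cuts \<Longrightarrow> K - (K - T) = T" for T
    using open_subset unfolding upper_cuts_def by blast
  ultimately show ?thesis
    by (auto simp: image_iff)
qed

end

section \<open>Cut systems and the refined order\<close>

text \<open>The data of the construction. The cells of stage \<open>n\<close>, the members of \<open>\<U> n\<close>, are disjoint open convex
  sets, not cut by any clopen final segment; each cell \<open>V\<close> has a chosen point \<open>p V\<close>, which no cell of a later
  stage contains, and a set \<open>S V\<close> that is clopen in \<open>M\<close> and differs from the final segment above \<open>V\<close> only
  inside \<open>V\<close>. Any two points are separated by a clopen final segment or by a whole cell between them.
  The assumptions are invariant under reversing the order and complementing all \<open>S V\<close>; in particular
  \<open>p V \<in> S V\<close> is deliberately not required.\<close>

locale cut_system = ordered_topology K lt L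
  for K :: "'a set" and lt (infix "\<lessdot>" 50) and L :: "'a topology" +
  fixes M :: "'a topology" and \<U> :: "nat \<Rightarrow> 'a set set"
    and p :: "'a set \<Rightarrow> 'a" and S :: "'a set \<Rightarrow> 'a set"
  assumes cell_open: "V \<in> \<U> n \<Longrightarrow> openin L V"
    and cell_convex: "V \<in> \<U> n \<Longrightarrow> convex_in V"
    and cell_disjoint: "V \<in> \<U> n \<Longrightarrow> W \<in> \<U> n \<Longrightarrow> V \<noteq> W \<Longrightarrow> V \<inter> W = {}"
    and cell_uncut: "V \<in> \<U> n \<Longrightarrow> T \<in> upper_cuts \<Longrightarrow> V \<subseteq> T \<or> V \<inter> T = {}"
    and point_in_cell: "V \<in> \<U> n \<Longrightarrow> p V \<in> V"
    and point_avoids: "V \<in> \<U> m \<Longrightarrow> W \<in> \<U> n \<Longrightarrow> m < n \<Longrightarrow> p V \<notin> W"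
    and cut_lower: "V \<in> \<U> n \<Longrightarrow> above V \<subseteq> S V"
    and cut_upper: "V \<in> \<U> n \<Longrightarrow> S V \<subseteq> above V \<union> V"
    and separated: "x \<lessdot> y \<Longrightarrow> (\<exists>T\<in>upper_cuts. x \<notin> T \<and> y \<in> T) \<or>
                       (\<exists>n. \<exists>V\<in>\<U> n. \<forall>v\<in>V. x \<lessdot> v \<and> v \<lessdot> y)"
    and topspace_M: "topspace M = K"
    and L_coarser: "openin L G \<Longrightarrow> openin M G"
    and cut_open: "V \<in> \<U> n \<Longrightarrow> openin M (S V)"
    and cut_co_open: "V \<in> \<U> n \<Longrightarrow> openin M (K - S V)"
begin

text \<open>The sequence of chains that defines the new order.\<close>

definition level :: "nat \<Rightarrow> 'a set set" where
  "level n = (case n of 0 \<Rightarrow> upper_cuts | Suc k \<Rightarrow> S ` \<U> k)"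

lemma level_0: "level 0 = upper_cuts"
  and level_Suc: "level (Suc k) = S ` \<U> k"
  by (simp_all add: level_def)

lemma cell_subset: "V \<in> \<U> n \<Longrightarrow> V \<subseteq> K"
  by (simp add: cell_open open_subset)

lemma cell_cases:
  assumes "V \<in> \<U> n" "W \<in> \<U> n" "V \<noteq> W"
  shows "(\<forall>v\<in>V. \<forall>w\<in>W. v \<lessdot> w) \<or> (\<forall>v\<in>V. \<forall>w\<in>W. w \<lessdot> v)"
  by (rule convex_disjoint_cases[OF cell_convex[OF assms(1)] cell_convex[OF assms(2)]
        cell_subset[OF assms(1)] cell_subset[OF assms(2)] cell_disjoint[OF assms]])

lemma cut_above_cell:
  assumes "V \<in> \<U> n" "W \<in> \<U> n" "\<forall>v\<in>V. \<forall>w\<in>W. v \<lessdot> w"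
  shows "S W \<subseteq> above V"
proof
  fix s assume "s \<in> S W"
  then have "s \<in> above W \<or> s \<in> W" "s \<in> K"
    using cut_upper[OF assms(2)] cell_subset[OF assms(2)] unfolding above_def by blast+
  then show "s \<in> above V"
    using assms(3) point_in_cell[OF assms(2)] lt_trans unfolding above_def by blast
qed

lemma level_open:
  assumes "A \<in> level n"
  shows "openin M A" "openin M (K - A)"
proof -
  show "openin M A"
    using assms L_coarser cut_open by (cases n) (auto simp: level_0 level_Suc upper_cuts_def)
  show "openin M (K - A)"
    using assms L_coarser cut_co_open by (cases n) (auto simp: level_0 level_Suc upper_cuts_def)
qed

lemma level_subset: "A \<in> level n \<Longrightarrow> A \<subseteq> K"
  using openin_subset[OF level_open(1)] topspace_M by simp

lemma level_separates:
  assumes "x \<lessdot> y"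
  shows "\<exists>n. \<exists>A\<in>level n. y \<in> A \<and> (\<forall>z\<in>A. x \<lessdot> z)"
  using separated[OF assms]
proof (elim disjE bexE exE conjE)
  fix T assume T: "T \<in> upper_cuts" "x \<notin> T" "y \<in> T"
  then have "x \<lessdot> z" if "z \<in> T" for z
    using that lt_linear[of x z] lt_carrier[OF assms] level_subset[of T 0]
    unfolding level_0 upper_cuts_def by blast
  then show ?thesis
    using T level_0 by blast
next
  fix n V assume V: "V \<in> \<U> n" "\<forall>v\<in>V. x \<lessdot> v \<and> v \<lessdot> y"
  have "y \<in> S V"
    using cut_lower[OF V(1)] V(2) lt_carrier[OF assms] unfolding above_def by blast
  moreover have "x \<lessdot> z" if "z \<in> S V" for z
    using that cut_upper[OF V(1)] V(2) point_in_cell[OF V(1)] lt_trans unfolding above_def by blast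
  ultimately show ?thesis
    using V(1) level_Suc by blast
qed

lemma level_chain_sequence: "chain_sequence K level"
proof
  show "A \<subseteq> B \<or> B \<subseteq> A" if AB: "A \<in> level n" "B \<in> level n" for A B n
  proof (cases n)
    case 0
    then show ?thesis using that upper_cuts_chain level_0 by blast
  next
    case (Suc k)
    then obtain V W where VW: "V \<in> \<U> k" "A = S V" "W \<in> \<U> k" "B = S W"
      using AB level_Suc by auto
    show ?thesis
    proof (cases "V = W")
      case False
      then show ?thesis
        using cell_cases[OF VW(1,3)] cut_above_cell[of V k W] cut_above_cell[of W k V]
          cut_lower[OF VW(1)] cut_lower[OF VW(3)] VW by blast
    qed (simp add: VW)
  qed
  show "\<exists>n. \<exists>A\<in>level n. (x \<in> A) = (y \<notin> A)" if xy: "x \<in> K" "y \<in> K" "x \<noteq> y" for x y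
  proof -
    consider "x \<lessdot> y" | "y \<lessdot> x"
      using lt_linear xy by blast
    then show ?thesis
    proof cases
      case 1
      then show ?thesis using level_separates[OF 1] lt_irrefl by blast
    next
      case 2
      then show ?thesis using level_separates[OF 2] lt_irrefl by blast
    qed
  qed
qed

sublocale levels: chain_sequence K level
  by (rule level_chain_sequence)

abbreviation lex :: "'a \<Rightarrow> 'a \<Rightarrow> bool" (infix "\<sqsubset>" 50) where
  "x \<sqsubset> y \<equiv> lex_less K level x y"

text \<open>The crux. Suppose that the points lexicographically below \<open>x\<close> and close to \<open>x\<close> agree with \<open>x\<close> before
  level \<open>m\<close>, but that level \<open>m\<close> separates some of them from \<open>x\<close>, however close they are taken. Then, in the
  given order, the members of level \<open>m\<close> that contain \<open>x\<close> shrink to the final segment starting at \<open>x\<close>, and \<open>x\<close>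
  is a limit from the left. For \<open>m > 0\<close> the chosen points of the cells that produce them converge to \<open>x\<close> too.
  As cells of later stages avoid these points, and no cell is cut by a member of level \<open>0\<close>, no cell used
  after level \<open>m\<close> contains \<open>x\<close>; so the later levels cut at \<open>x\<close> as in the given order.\<close>

lemma breaking_level:
  assumes N: "openin M N" "x \<in> N" "\<forall>y\<in>N. y \<sqsubset> x \<longrightarrow> agree level m y x"
    and break: "\<forall>H. openin M H \<and> x \<in> H \<longrightarrow> (\<exists>y\<in>H. y \<sqsubset> x \<and> \<not> agree level (Suc m) y x)"
  shows "\<And>y. y \<lessdot> x \<Longrightarrow> \<exists>A\<in>level m. x \<in> A \<and> (\<forall>z\<in>A. y \<lessdot> z)"
    and "\<And>A z. A \<in> level m \<Longrightarrow> x \<in> A \<Longrightarrow> x \<lessdot> z \<Longrightarrow> z \<in> A"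
    and "\<And>j A. m < j \<Longrightarrow> A \<in> level j \<Longrightarrow> x \<in> A \<Longrightarrow>
           (\<forall>z. x \<lessdot> z \<longrightarrow> z \<in> A) \<and> (\<exists>B\<in>level m. x \<in> B \<and> B \<subseteq> A)"
    and "\<And>j A z. m < j \<Longrightarrow> A \<in> level j \<Longrightarrow> x \<notin> A \<Longrightarrow> z \<in> A \<Longrightarrow> x \<lessdot> z"
    and "\<And>G. openin L G \<Longrightarrow> x \<in> G \<Longrightarrow> \<exists>y\<in>G. y \<lessdot> x"
proof -
  define \<A> where "\<A> = {A \<in> level m. x \<in> A}"
  have xK: "x \<in> K"
    using N openin_subset topspace_M by blast
  have not_nbhd: "\<exists>y\<in>H. \<exists>A\<in>\<A>. y \<notin> A" if H: "openin M H" "x \<in> H" for H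
  proof -
    obtain y where y: "y \<in> N" "y \<in> H" "y \<sqsubset> x" "\<not> agree level (Suc m) y x"
      using break[rule_format, of "N \<inter> H"] N H by (auto simp: openin_Int)
    then have ag: "agree level m y x"
      using N(3) by blast
    then obtain A where "A \<in> level m" "(y \<in> A) \<noteq> (x \<in> A)"
      using y(4) by (auto simp: agree_Suc)
    then show ?thesis
      using levels.lex_less_mono[OF y(3) ag] y(2) unfolding \<A>_def by blast
  qed
  \<comment> \<open>The members of \<open>\<A>\<close> have no smallest one, for it would be an open neighbourhood of \<open>x\<close>.\<close>
  have next_cell: "\<exists>W\<in>\<U> k. x \<in> S W \<and> (\<forall>v\<in>V. \<forall>w\<in>W. v \<lessdot> w)"
    if m: "m = Suc k" and V: "V \<in> \<U> k" "x \<in> S V" for k V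
  proof -
    obtain y A where y: "y \<in> S V" "A \<in> \<A>" "y \<notin> A"
      using not_nbhd[OF cut_open[OF V(1)] V(2)] by blast
    then obtain W where W: "W \<in> \<U> k" "A = S W" "x \<in> S W"
      using m level_Suc unfolding \<A>_def by auto
    have "V \<noteq> W"
      using y W by blast
    moreover have "S V \<subseteq> S W" if "\<forall>v\<in>V. \<forall>w\<in>W. w \<lessdot> v"
      using cut_above_cell[OF W(1) V(1)] cut_lower[OF W(1)] that by blast
    ultimately show ?thesis
      using cell_cases[OF V(1) W(1)] y W by blast
  qed
  have final: "z \<in> A" if y: "\<forall>A\<in>\<A>. y \<in> A" and A: "A \<in> \<A>" and z: "y \<lessdot> z" for y z A
  proof (cases m)
    case 0
    then show ?thesis
      using A y z level_0 unfolding \<A>_def upper_cuts_def by blast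
  next
    case (Suc k)
    then obtain V where V: "V \<in> \<U> k" "A = S V" "x \<in> S V"
      using A level_Suc unfolding \<A>_def by auto
    obtain W where W: "W \<in> \<U> k" "x \<in> S W" "\<forall>v\<in>V. \<forall>w\<in>W. v \<lessdot> w"
      using next_cell[OF Suc V(1,3)] by blast
    have "y \<in> above V"
      using y W Suc level_Suc cut_above_cell[OF V(1) W(1,3)] unfolding \<A>_def by auto
    then have "z \<in> above V"
      using z lt_trans lt_carrier unfolding above_def by blast
    then show ?thesis
      using cut_lower[OF V(1)] V(2) by blast
  qed
  have below: "\<exists>A\<in>\<A>. \<forall>z\<in>A. y \<lessdot> z" if y: "y \<lessdot> x" for y
  proof -
    have "\<exists>A\<in>\<A>. y \<notin> A"
    proof (rule ccontr)
      assume "\<not> ?thesis"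
      then have "\<forall>A\<in>\<A>. y \<in> A"
        by blast
      then show False
        using not_nbhd[OF L_coarser[OF open_above[of y]]] final y by blast
    qed
    then obtain A where A: "A \<in> \<A>" "y \<notin> A"
      by blast
    have yK: "y \<in> K"
      using y lt_carrier by blast
    show ?thesis
    proof (cases m)
      case 0
      then have "\<forall>z\<in>A. y \<lessdot> z"
        using A level_0 lt_linear[OF yK] level_subset[of A m]
        unfolding \<A>_def upper_cuts_def by blast
      then show ?thesis using A(1) by blast
    next
      case (Suc k)
      then obtain V where V: "V \<in> \<U> k" "A = S V" "x \<in> S V"
        using A level_Suc unfolding \<A>_def by auto
      obtain W where W: "W \<in> \<U> k" "x \<in> S W" "\<forall>v\<in>V. \<forall>w\<in>W. v \<lessdot> w"
        using next_cell[OF Suc V(1,3)] by blast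
      have "y \<notin> above V"
        using cut_lower[OF V(1)] A(2) V(2) by blast
      then obtain v where v: "v \<in> V" "y = v \<or> y \<lessdot> v"
        using yK lt_linear[OF yK] cell_subset[OF V(1)] unfolding above_def by blast
      have "\<forall>z\<in>S W. y \<lessdot> z"
        using cut_above_cell[OF V(1) W(1,3)] v lt_trans unfolding above_def by blast
      moreover have "S W \<in> \<A>"
        using W Suc level_Suc unfolding \<A>_def by blast
      ultimately show ?thesis by blast
    qed
  qed
  have limit: "\<exists>y\<in>G. y \<lessdot> x" if G: "openin L G" "x \<in> G" for G
  proof (rule ccontr)
    assume "\<not> ?thesis"
    then have "\<forall>y\<in>G. y = x \<or> x \<lessdot> y"
      using lt_linear[OF xK] open_subset[OF G(1)] by blast
    moreover obtain y A where "y \<in> G" "A \<in> \<A>" "y \<notin> A"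
      using not_nbhd[OF L_coarser[OF G(1)] G(2)] by blast
    moreover have "\<forall>A\<in>\<A>. x \<in> A"
      unfolding \<A>_def by blast
    ultimately show False
      using final[of x A y] by metis
  qed
  \<comment> \<open>Between \<open>y\<close> and \<open>x\<close> lies the chosen point of a cell of level \<open>m\<close>, and a member of \<open>\<A>\<close> lies entirely above it.\<close>
  have point_between: "\<exists>V\<in>\<U> k. y \<lessdot> p V \<and> p V \<lessdot> x \<and> (\<exists>A\<in>\<A>. \<forall>a\<in>A. p V \<lessdot> a)"
    if m: "m = Suc k" and y: "y \<lessdot> x" for k y
  proof -
    obtain A where A: "A \<in> \<A>" "\<forall>z\<in>A. y \<lessdot> z"
      using below[OF y] by blast
    then obtain V where V: "V \<in> \<U> k" "A = S V" "x \<in> S V"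
      using m level_Suc unfolding \<A>_def by auto
    obtain W where W: "W \<in> \<U> k" "x \<in> S W" "\<forall>v\<in>V. \<forall>w\<in>W. v \<lessdot> w"
      using next_cell[OF m V(1,3)] by blast
    obtain W' where W': "W' \<in> \<U> k" "x \<in> S W'" "\<forall>v\<in>W. \<forall>w\<in>W'. v \<lessdot> w"
      using next_cell[OF m W(1,2)] by blast
    have pW: "p W \<in> W"
      by (rule point_in_cell[OF W(1)])
    have "p W \<in> above V"
      using pW W(3) cell_subset[OF W(1)] unfolding above_def by blast
    then have "y \<lessdot> p W"
      using cut_lower[OF V(1)] A(2) V(2) by blast
    moreover have "\<forall>a\<in>S W'. p W \<lessdot> a"
      using cut_above_cell[OF W(1) W'(1,3)] pW unfolding above_def by blast
    moreover have "S W' \<in> \<A>"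
      using W' m level_Suc unfolding \<A>_def by blast
    ultimately show ?thesis
      using W(1) W'(2) by blast
  qed
  have later: "x \<notin> U" if U: "U \<in> \<U> k" "m < Suc k" for U k
  proof
    assume xU: "x \<in> U"
    obtain y where y: "y \<in> U" "y \<lessdot> x"
      using limit[OF cell_open[OF U(1)] xU] by blast
    show False
    proof (cases m)
      case 0
      obtain A where "A \<in> \<A>" "\<forall>z\<in>A. y \<lessdot> z"
        using below[OF y(2)] by blast
      then show False
        using cell_uncut[OF U(1), of A] y xU lt_irrefl 0 level_0 unfolding \<A>_def by blast
    next
      case (Suc l)
      obtain V where "V \<in> \<U> l" "y \<lessdot> p V" "p V \<lessdot> x"
        using point_between[OF Suc y(2)] by blast
      then show False
        using convex_inD[OF cell_convex[OF U(1)] y(1) xU] point_avoids[of V l U k] U Suc by simp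
    qed
  qed
  have side: "(\<forall>v\<in>U. v \<lessdot> x) \<or> (\<forall>v\<in>U. x \<lessdot> v)" if "U \<in> \<U> k" "m < Suc k" for U k
    using convex_side cell_convex cell_subset xK later that by blast
  show "\<exists>A\<in>level m. x \<in> A \<and> (\<forall>z\<in>A. y \<lessdot> z)" if "y \<lessdot> x" for y
    using below[OF that] unfolding \<A>_def by blast
  show "z \<in> A" if "A \<in> level m" "x \<in> A" "x \<lessdot> z" for A z
    using final[of x A z] that unfolding \<A>_def by blast
  show "\<exists>y\<in>G. y \<lessdot> x" if "openin L G" "x \<in> G" for G
    using limit that by blast
  show "(\<forall>z. x \<lessdot> z \<longrightarrow> z \<in> A) \<and> (\<exists>B\<in>level m. x \<in> B \<and> B \<subseteq> A)"
    if j: "m < j" and A: "A \<in> level j" "x \<in> A" for j A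
  proof -
    obtain k where k: "j = Suc k"
      using j by (cases j) auto
    then obtain U where U: "U \<in> \<U> k" "A = S U"
      using A level_Suc by auto
    have xa: "\<forall>v\<in>U. v \<lessdot> x"
      using A U cut_upper[OF U(1)] later[of U k] j k unfolding above_def by blast
    have pU: "p U \<in> U" "p U \<lessdot> x"
      using point_in_cell[OF U(1)] xa by blast+
    have "\<exists>B\<in>\<A>. B \<subseteq> above U"
    proof (cases m)
      case 0
      obtain B where B: "B \<in> \<A>" "\<forall>z\<in>B. p U \<lessdot> z"
        using below[OF pU(2)] by blast
      have BT: "B \<in> upper_cuts" "B \<subseteq> K"
        using B(1) 0 level_0 level_subset unfolding \<A>_def by auto
      have "U \<inter> B = {}"
        using cell_uncut[OF U(1) BT(1)] pU B(2) lt_irrefl by blast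
      then have "v \<lessdot> b" if "v \<in> U" "b \<in> B" for v b
        using that lt_linear[of v b] BT cell_subset[OF U(1)] unfolding upper_cuts_def by blast
      then show ?thesis
        using B(1) BT(2) unfolding above_def by blast
    next
      case (Suc l)
      obtain V B where V: "V \<in> \<U> l" "p U \<lessdot> p V" "p V \<lessdot> x" and B: "B \<in> \<A>" "\<forall>a\<in>B. p V \<lessdot> a"
        using point_between[OF Suc pU(2)] by blast
      have "p V \<notin> U"
        using point_avoids[OF V(1) U(1)] Suc j k by simp
      moreover have "p V \<in> K"
        using V lt_carrier by blast
      ultimately have "\<forall>u\<in>U. u \<lessdot> p V"
        using convex_side[OF cell_convex[OF U(1)] cell_subset[OF U(1)]] V(2) pU(1) lt_asym by blast
      then have "B \<subseteq> above U"
        using B(2) lt_trans lt_carrier unfolding above_def by blast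
      then show ?thesis using B(1) by blast
    qed
    moreover have "\<forall>z. x \<lessdot> z \<longrightarrow> z \<in> above U"
      using xa lt_trans lt_carrier unfolding above_def by blast
    ultimately show ?thesis
      using cut_lower[OF U(1)] U(2) unfolding \<A>_def by blast
  qed
  show "x \<lessdot> z" if j: "m < j" and A: "A \<in> level j" "x \<notin> A" "z \<in> A" for j A z
  proof -
    obtain k where k: "j = Suc k"
      using j by (cases j) auto
    then obtain U where U: "U \<in> \<U> k" "A = S U"
      using A level_Suc by auto
    have "x \<notin> above U"
      using A U cut_lower[OF U(1)] by blast
    then have "\<forall>v\<in>U. x \<lessdot> v"
      using side[OF U(1)] j k xK unfolding above_def by blast
    moreover have "z \<in> above U \<or> z \<in> U"
      using cut_upper[OF U(1)] A U by blast
    ultimately show ?thesis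
      using point_in_cell[OF U(1)] lt_trans unfolding above_def by blast
  qed
qed

end

context cut_system
begin

lemma dual_cut_system: "cut_system K (\<lambda>x y. y \<lessdot> x) L M \<U> p (\<lambda>V. K - S V)"
proof -
  interpret dual: ordered_topology K "\<lambda>x y. y \<lessdot> x" L
    by (rule dual_ordered_topology)
  have above_cell: "dual.above V \<union> V \<union> above V = K" "dual.above V \<inter> (above V \<union> V) = {}"
    if V: "V \<in> \<U> n" for V n
  proof -
    show "dual.above V \<union> V \<union> above V = K"
      using convex_side[OF cell_convex[OF V] cell_subset[OF V]] cell_subset[OF V]
      unfolding dual.above_def above_def by blast
    show "dual.above V \<inter> (above V \<union> V) = {}"
      using point_in_cell[OF V] lt_asym lt_irrefl unfolding dual.above_def above_def by blast
  qed
  show ?thesis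
  proof
    show "openin M (K - (K - S V))" if "V \<in> \<U> n" for V n
      using cut_open[OF that] openin_subset[OF cut_open[OF that]] topspace_M by (simp add: double_diff)
    show "V \<subseteq> T \<or> V \<inter> T = {}" if "V \<in> \<U> n" "T \<in> dual.upper_cuts" for V n T
      using cell_uncut[OF that(1)] that(2) cell_subset[OF that(1)] unfolding dual_upper_cuts by blast
    show "dual.above V \<subseteq> K - S V" if "V \<in> \<U> n" for V n
      using above_cell[OF that] cut_upper[OF that] by blast
    show "K - S V \<subseteq> dual.above V \<union> V" if "V \<in> \<U> n" for V n
      using above_cell[OF that] cut_lower[OF that] by blast
    show "(\<exists>T\<in>dual.upper_cuts. x \<notin> T \<and> y \<in> T) \<or>
          (\<exists>n. \<exists>V\<in>\<U> n. \<forall>v\<in>V. v \<lessdot> x \<and> y \<lessdot> v)" if "y \<lessdot> x" for x y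
      using separated[OF that] lt_carrier[OF that] unfolding dual_upper_cuts by auto
  qed (use cell_open cell_convex cell_disjoint point_in_cell point_avoids topspace_M L_coarser cut_co_open
        in \<open>auto simp: dual_convex_in\<close>)
qed

lemma dual_level: "cut_system.level K (\<lambda>x y. y \<lessdot> x) L \<U> (\<lambda>V. K - S V) n = (\<lambda>A. K - A) ` level n"
proof -
  interpret dual: cut_system K "\<lambda>x y. y \<lessdot> x" L M \<U> p "\<lambda>V. K - S V"
    by (rule dual_cut_system)
  show ?thesis
    by (cases n) (simp_all add: dual.level_0 dual.level_Suc level_0 level_Suc dual_upper_cuts image_image)
qed

lemma dual_lex:
  "lex_less K (cut_system.level K (\<lambda>x y. y \<lessdot> x) L \<U> (\<lambda>V. K - S V)) x y \<longleftrightarrow> y \<sqsubset> x"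
  using lex_less_complement[of level K x y] level_subset by (simp add: dual_level[abs_def])

text \<open>In an open convex set each point \<open>x\<close> is shielded from the smaller points outside the set by a single
  member of a level. If \<open>x\<close> is the least point of the set, this is the clopen final segment starting at \<open>x\<close>.\<close>

lemma lower_barrier:
  assumes "openin L G" "x \<in> G" "convex_in G"
  shows "\<exists>n. \<exists>A\<in>level n. x \<in> A \<and> (\<forall>z\<in>A. z \<lessdot> x \<longrightarrow> z \<in> G)"
proof (cases "\<exists>y\<in>G. y \<lessdot> x")
  case True
  then obtain y where y: "y \<in> G" "y \<lessdot> x"
    by blast
  obtain n A where "A \<in> level n" "x \<in> A" "\<forall>z\<in>A. y \<lessdot> z"
    using level_separates[OF y(2)] by blast
  moreover have "z \<in> G" if "y \<lessdot> z" "z \<lessdot> x" for z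
    by (rule convex_inD[OF assms(3) y(1) assms(2) that])
  ultimately show ?thesis by blast
next
  case False
  define T where "T = {z. z = x \<or> x \<lessdot> z}"
  have xK: "x \<in> K"
    using assms open_subset by blast
  have "T = G \<union> {z. x \<lessdot> z}"
    using False assms(2) lt_linear[OF xK] open_subset[OF assms(1)] unfolding T_def by blast
  then have "openin L T"
    by (simp add: assms(1) open_above openin_Un)
  moreover have "K - T = {z. z \<lessdot> x}"
    using lt_linear[OF xK] lt_irrefl lt_asym lt_carrier unfolding T_def by blast
  then have "openin L (K - T)"
    by (simp add: open_below)
  moreover have "y \<in> T" if "z \<in> T" "z \<lessdot> y" for z y
    using that lt_trans unfolding T_def by blast
  ultimately have "T \<in> level 0"
    unfolding level_0 upper_cuts_def by blast
  moreover have "x \<in> T" "\<forall>z\<in>T. \<not> z \<lessdot> x"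
    using lt_irrefl lt_asym unfolding T_def by blast+
  ultimately show ?thesis by blast
qed

lemma upper_barrier:
  assumes "openin L G" "x \<in> G" "convex_in G"
  shows "\<exists>n. \<exists>A\<in>level n. x \<notin> A \<and> (\<forall>z\<in>K - A. x \<lessdot> z \<longrightarrow> z \<in> G)"
proof -
  interpret dual: cut_system K "\<lambda>x y. y \<lessdot> x" L M \<U> p "\<lambda>V. K - S V"
    by (rule dual_cut_system)
  have "dual.convex_in G"
    using assms(3) by (simp add: dual_convex_in)
  from dual.lower_barrier[OF assms(1,2) this] show ?thesis
    unfolding dual_level by blast
qed

text \<open>If every lexicographic class of \<open>x\<close> captures \<open>x\<close> from below, then classes of a sufficiently high level
  prove the claim; otherwise the first level where this fails is a breaking level.\<close>

lemma captures_below_generator: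
  assumes x: "x \<in> G" and G: "openin L G \<or> (\<exists>n. \<exists>A\<in>level n. G = A \<or> G = K - A)"
  shows "captures_below M (\<sqsubset>) G x"
proof -
  define near where "near k N \<longleftrightarrow> openin M N \<and> x \<in> N \<and> (\<forall>y\<in>N. y \<sqsubset> x \<longrightarrow> agree level k y x)" for k N
  have xK: "x \<in> K"
    using x G open_subset level_subset by blast
  have near_agree: "agree level k z x" if "near k N" "y \<in> N" "z = y \<or> y \<sqsubset> z" "z \<sqsubset> x" for k N y z
  proof (cases "z = y")
    case False
    then have "y \<sqsubset> z" using that by blast
    then have "y \<sqsubset> x" using levels.lex_less_trans that(4) by blast
    then have yx: "agree level k y x" using that unfolding near_def by blast
    show ?thesis
      by (rule agree_trans[OF agree_sym[OF levels.lex_less_between[OF \<open>y \<sqsubset> z\<close> that(4) yx]] yx])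
  next
    case True
    then show ?thesis using that(1,2,4) unfolding near_def by blast
  qed
  have agree_capture: "captures_below M (\<sqsubset>) G x"
    if "near (Suc j) N" "A \<in> level j" "G = A \<or> G = K - A" for j A N
  proof (rule captures_belowI[of M N])
    show "z \<in> G" if "y \<in> N" "z = y \<or> y \<sqsubset> z" "z \<sqsubset> x" for y z
    proof -
      have "z \<in> K" using \<open>z \<sqsubset> x\<close> unfolding lex_less_def by blast
      then show ?thesis
        using near_agree[OF \<open>near (Suc j) N\<close> that] \<open>A \<in> level j\<close> \<open>G = A \<or> G = K - A\<close> x
        unfolding agree_Suc by blast
    qed
  qed (use that x near_def in blast)+
  show ?thesis
  proof (cases "\<forall>k. \<exists>N. near k N")
    case True
    from G show ?thesis
    proof (elim disjE exE bexE)
      assume "openin L G"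
      then obtain C where C: "openin L C" "x \<in> C" "C \<subseteq> G" "convex_in C"
        using convex_base x by blast
      obtain i A where A: "A \<in> level i" "x \<in> A" "\<forall>z\<in>A. z \<lessdot> x \<longrightarrow> z \<in> C"
        using lower_barrier[OF C(1,2,4)] by blast
      obtain j B where B: "B \<in> level j" "x \<notin> B" "\<forall>z\<in>K - B. x \<lessdot> z \<longrightarrow> z \<in> C"
        using upper_barrier[OF C(1,2,4)] by blast
      obtain N where N: "near (Suc (max i j)) N"
        using True by blast
      show ?thesis
      proof (rule captures_belowI[of M N])
        show "z \<in> G" if "y \<in> N" "z = y \<or> y \<sqsubset> z" "z \<sqsubset> x" for y z
        proof -
          have "agree level (Suc i) z x" "agree level (Suc j) z x"
            using near_agree[OF N that] agree_mono by force+
          then have "z \<in> A" "z \<notin> B"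
            using A(1,2) B(1,2) unfolding agree_Suc by blast+
          moreover have "z \<in> K" using \<open>z \<sqsubset> x\<close> unfolding lex_less_def by blast
          ultimately show ?thesis
            using A(3) B(3) C(2,3) lt_linear[OF xK] by blast
        qed
      qed (use N x near_def in blast)+
    next
      fix n A assume "A \<in> level n" "G = A"
      then show ?thesis using agree_capture True by blast
    next
      fix n A assume "A \<in> level n" "G = K - A"
      then show ?thesis using agree_capture True by blast
    qed
  next
    case False
    \<comment> \<open>Level \<open>0\<close> imposes no condition, so \<open>m'\<close> is a successor and its predecessor \<open>m\<close> is the breaking level.\<close>
    define m' where "m' = (LEAST k. \<nexists>N. near k N)"
    have m': "\<nexists>N. near m' N" "\<And>k. k < m' \<Longrightarrow> \<exists>N. near k N"
      using LeastI_ex[of "\<lambda>k. \<nexists>N. near k N"] not_less_Least[of _ "\<lambda>k. \<nexists>N. near k N"] False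
      unfolding m'_def by blast+
    have "near 0 K"
      using xK openin_topspace[of M] topspace_M unfolding near_def agree_def by simp
    then obtain m where m: "m' = Suc m"
      using m'(1) by (cases m') auto
    then obtain N where N: "near m N"
      using m'(2) by blast
    have N': "openin M N" "x \<in> N" "\<forall>y\<in>N. y \<sqsubset> x \<longrightarrow> agree level m y x"
      using N unfolding near_def by blast+
    have "\<forall>H. openin M H \<and> x \<in> H \<longrightarrow> (\<exists>y\<in>H. y \<sqsubset> x \<and> \<not> agree level (Suc m) y x)"
      using m'(1) unfolding m near_def by blast
    note breaking = breaking_level[OF N' this]
    have keep: "z \<in> A" if "y \<in> N" "z = y \<or> y \<sqsubset> z" "z \<sqsubset> x" "A \<in> level m" "y \<in> A" for y z A
    proof (cases "z = y")
      case False
      then have "y \<sqsubset> z" using that by blast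
      moreover have "agree level m y z"
        using agree_trans[OF near_agree[OF N \<open>y \<in> N\<close>, of y]
            agree_sym[OF near_agree[OF N \<open>y \<in> N\<close> that(2,3)]]]
          levels.lex_less_trans[OF \<open>y \<sqsubset> z\<close> that(3)] by blast
      ultimately show ?thesis
        using levels.lex_less_mono that by blast
    qed (use that in simp)
    \<comment> \<open>In the class of \<open>x\<close> before the breaking level, below \<open>x\<close> in the new order implies below \<open>x\<close> in the given one.\<close>
    have left: "z \<lessdot> x" if zx: "agree level m z x" "z \<sqsubset> x" for z
    proof (rule ccontr)
      assume "\<not> z \<lessdot> x"
      then have z: "x \<lessdot> z"
        using zx(2) lt_linear[OF xK, of z] levels.lex_less_irrefl unfolding lex_less_def by blast
      obtain n A where A: "agree level n z x" "A \<in> level n" "z \<notin> A" "x \<in> A"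
        using zx(2) unfolding lex_less_def by blast
      have "\<not> n < m"
        using A zx(1) unfolding agree_def by blast
      then consider "n = m" | "m < n" by linarith
      then show False
        using breaking(2)[of A z] breaking(3)[of n A] A z by cases blast+
    qed
    have capture_in: "captures_below M (\<sqsubset>) G x"
      if B: "B \<in> level m" "x \<in> B" "\<And>z. z \<in> B \<Longrightarrow> z \<lessdot> x \<Longrightarrow> z \<in> G" for B
    proof (rule captures_belowI[of M "N \<inter> B"])
      show "openin M (N \<inter> B)"
        using N' level_open(1)[OF B(1)] by blast
      show "z \<in> G" if "y \<in> N \<inter> B" "z = y \<or> y \<sqsubset> z" "z \<sqsubset> x" for y z
        using keep[of y z B] left near_agree[OF N, of y z] B that by blast
    qed (use B N' x in blast)+
    from G show ?thesis
    proof (elim disjE exE bexE)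
      assume "openin L G"
      then obtain C where C: "openin L C" "x \<in> C" "C \<subseteq> G" "convex_in C"
        using convex_base x by blast
      obtain y where y: "y \<in> C" "y \<lessdot> x"
        using breaking(5)[OF C(1,2)] by blast
      obtain B where "B \<in> level m" "x \<in> B" "\<forall>z\<in>B. y \<lessdot> z"
        using breaking(1)[OF y(2)] by blast
      then show ?thesis
        using capture_in[of B] convex_inD[OF C(4) y(1) C(2)] C(3) by blast
    next
      fix n A assume A: "A \<in> level n" "G = A"
      consider "n < m" | "n = m" | "m < n" by linarith
      then show ?thesis
      proof cases
        case 1
        then have "near (Suc n) N"
          using N agree_mono[of level m _ x "Suc n"] unfolding near_def by (meson Suc_leI)
        then show ?thesis using agree_capture A by blast
      next
        case 2
        then show ?thesis using capture_in[of A] A x by blast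
      next
        case 3
        then show ?thesis using breaking(3)[OF 3 A(1)] capture_in A(2) x by blast
      qed
    next
      fix n A assume A: "A \<in> level n" "G = K - A"
      consider "n < m" | "n = m" | "m < n" by linarith
      then show ?thesis
      proof cases
        case 1
        then have "near (Suc n) N"
          using N agree_mono[of level m _ x "Suc n"] unfolding near_def by (meson Suc_leI)
        then show ?thesis using agree_capture A by blast
      next
        case 2
        show ?thesis
        proof (rule captures_belowI[of M N])
          show "z \<in> G" if "y \<in> N" "z = y \<or> y \<sqsubset> z" "z \<sqsubset> x" for y z
            using levels.lex_less_mono[OF that(3) near_agree[OF N that]] A 2 x that(3)
            unfolding lex_less_def by blast
        qed (use N' x in blast)+
      next
        case 3
        show ?thesis
        proof (rule captures_belowI[of M N])
          show "z \<in> G" if "y \<in> N" "z = y \<or> y \<sqsubset> z" "z \<sqsubset> x" for y z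
            using left[OF near_agree[OF N that] that(3)] breaking(4)[OF 3 A(1), of z] A(2) x lt_asym lt_carrier
            by blast
        qed (use N' x in blast)+
      qed
    qed
  qed
qed

lemma captures_above_generator:
  assumes "x \<in> G" "openin L G \<or> (\<exists>n. \<exists>A\<in>level n. G = A \<or> G = K - A)"
  shows "captures_below M (\<lambda>x y. y \<sqsubset> x) G x"
proof -
  interpret dual: cut_system K "\<lambda>x y. y \<lessdot> x" L M \<U> p "\<lambda>V. K - S V"
    by (rule dual_cut_system)
  have "openin L G \<or> (\<exists>n. \<exists>A\<in>dual.level n. G = A \<or> G = K - A)"
    using assms(2) level_subset unfolding dual_level by (auto 4 3 simp: double_diff)
  from dual.captures_below_generator[OF assms(1) this] show ?thesis
    by (simp add: dual_lex)
qed

end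

context cut_system
begin

text \<open>The subbase of the refined topology.\<close>

definition generators :: "'a set set" where
  "generators = {G. openin L G} \<union> (\<Union>n. S ` \<U> n \<union> (\<lambda>V. K - S V) ` \<U> n)"

lemma generator_level:
  assumes "G \<in> generators"
  shows "openin L G \<or> (\<exists>n. \<exists>A\<in>level n. G = A \<or> G = K - A)"
proof -
  consider "openin L G" | n V where "V \<in> \<U> n" "G = S V \<or> G = K - S V"
    using assms unfolding generators_def by blast
  then show ?thesis
  proof cases
    case (2 n V)
    then have "S V \<in> level (Suc n)"
      by (simp add: level_Suc)
    then show ?thesis using 2(2) by blast
  qed simp
qed

context
  assumes M_generated: "M = topology_generated_by generators"
begin

lemma Hausdorff_refined:
  assumes "Hausdorff_space L"
  shows "Hausdorff_space M"
  unfolding Hausdorff_space_def topspace_M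
proof (intro allI impI)
  fix x y assume "x \<in> K \<and> y \<in> K \<and> x \<noteq> y"
  then obtain U V where "openin L U" "openin L V" "x \<in> U" "y \<in> V" "disjnt U V"
    using assms unfolding Hausdorff_space_def topspace_L by metis
  then show "\<exists>U V. openin M U \<and> openin M V \<and> x \<in> U \<and> y \<in> V \<and> disjnt U V"
    using L_coarser by blast
qed

lemma generate_topology_on_refined: "openin M G \<Longrightarrow> generate_topology_on generators G"
  using openin_topology_generated_by[of generators G] unfolding M_generated[symmetric] .

lemma GO_space_refined:
  assumes "Hausdorff_space L"
  shows "GO_space M"
proof (rule GO_space_if_captures[OF topspace_M levels.strict_linear_lex_less Hausdorff_refined[OF assms]])
  fix G x assume G: "openin M G" "x \<in> G"
  note gen = generate_topology_on_refined[OF G(1)]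
  show "captures_below M (\<sqsubset>) G x"
    by (rule captures_below_generated[OF _ gen G(2)]) (rule captures_below_generator[OF _ generator_level])
  show "captures_below M (\<lambda>x y. y \<sqsubset> x) G x"
    by (rule captures_below_generated[OF _ gen G(2)]) (rule captures_above_generator[OF _ generator_level])
qed

lemma dim_le_0_refined: "M dim_le 0"
proof -
  define P where "P G \<longleftrightarrow> (\<forall>x\<in>G. \<exists>C. openin M C \<and> closedin M C \<and> x \<in> C \<and> C \<subseteq> G)" for G
  have level_clopen: "openin M A" "closedin M A" "openin M (K - A)" "closedin M (K - A)"
    if "A \<in> level n" for A n
    using level_open[OF that] level_subset[OF that] by (simp_all add: closedin_def topspace_M double_diff)
  have P: "P G" if "generate_topology_on generators G" for G
    using that
  proof induction
    case Empty
    then show ?case by (simp add: P_def)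
  next
    case (Int G H)
    show ?case
      unfolding P_def
    proof
      fix x assume "x \<in> G \<inter> H"
      then obtain C D where "openin M C" "closedin M C" "x \<in> C" "C \<subseteq> G"
        "openin M D" "closedin M D" "x \<in> D" "D \<subseteq> H"
        using Int.IH unfolding P_def by (meson IntD1 IntD2)
      then show "\<exists>E. openin M E \<and> closedin M E \<and> x \<in> E \<and> E \<subseteq> G \<inter> H"
        by (intro exI[of _ "C \<inter> D"]) auto
    qed
  next
    case (UN \<K>)
    show ?case
      unfolding P_def
    proof
      fix x assume "x \<in> \<Union>\<K>"
      then obtain k where k: "k \<in> \<K>" "x \<in> k"
        by blast
      then obtain C where "openin M C" "closedin M C" "x \<in> C" "C \<subseteq> k"
        using UN.IH[OF k(1)] unfolding P_def by blast
      then show "\<exists>C. openin M C \<and> closedin M C \<and> x \<in> C \<and> C \<subseteq> \<Union>\<K>"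
        using k(1) by blast
    qed
  next
    case (Basis G)
    show ?case
      unfolding P_def
    proof
      fix x assume x: "x \<in> G"
      from generator_level[OF Basis]
      show "\<exists>C. openin M C \<and> closedin M C \<and> x \<in> C \<and> C \<subseteq> G"
      proof (elim disjE exE bexE)
        assume "openin L G"
        then obtain H where H: "openin L H" "x \<in> H" "H \<subseteq> G" "convex_in H"
          using convex_base x by blast
        obtain i A where A: "A \<in> level i" "x \<in> A" "\<forall>z\<in>A. z \<lessdot> x \<longrightarrow> z \<in> H"
          using lower_barrier[OF H(1,2,4)] by blast
        obtain j B where B: "B \<in> level j" "x \<notin> B" "\<forall>z\<in>K - B. x \<lessdot> z \<longrightarrow> z \<in> H"
          using upper_barrier[OF H(1,2,4)] by blast
        have xK: "x \<in> K"
          using H open_subset by blast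
        have "A \<inter> (K - B) \<subseteq> G"
          using A(3) B(3) H(2,3) lt_linear[OF xK] by blast
        then show ?thesis
          using level_clopen[OF A(1)] level_clopen[OF B(1)] A(2) B(2) xK
          by (intro exI[of _ "A \<inter> (K - B)"]) auto
      next
        fix n A assume "A \<in> level n" "G = A"
        then show ?thesis using level_clopen[of A n] x by blast
      next
        fix n A assume "A \<in> level n" "G = K - A"
        then show ?thesis using level_clopen[of A n] x by blast
      qed
    qed
  qed
  have clopen: "\<exists>C. openin M C \<and> closedin M C \<and> x \<in> C \<and> C \<subseteq> G" if "openin M G" "x \<in> G" for G x
  proof -
    show ?thesis
      using P[OF generate_topology_on_refined[OF that(1)]] that(2) unfolding P_def by blast
  qed
  then have "\<exists>U V. openin M U \<and> (closedin M V \<and> openin M V) \<and> x \<in> U \<and> U \<subseteq> V \<and> V \<subseteq> G"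
    if G: "openin M G" "x \<in> G" for G x
  proof -
    obtain C where "openin M C" "closedin M C" "x \<in> C" "C \<subseteq> G"
      using clopen[OF G] by blast
    then show ?thesis by (intro exI[of _ C]) simp
  qed
  then show ?thesis
    unfolding dimension_le_0_neighbourhood_base_of_clopen neighbourhood_base_of by simp
qed

end

end

section \<open>Barriers and cells\<close>

context strict_linear
begin

lemma convex_Un:
  assumes "convex_in C" "convex_in D" "C \<subseteq> K" "D \<subseteq> K" "w \<in> C" "w \<in> D"
  shows "convex_in (C \<union> D)"
  unfolding convex_in_def
proof (intro ballI allI impI)
  have *: "y \<in> A \<union> B"
    if AB: "convex_in A" "convex_in B" "w \<in> A" "w \<in> B" "w \<in> K" "x \<in> A" "z \<in> B" "x \<lessdot> y" "y \<lessdot> z" for A B x y z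
  proof -
    consider "y = w" | "y \<lessdot> w" | "w \<lessdot> y"
      using lt_linear[of y w] AB(5) lt_carrier[OF AB(8)] by blast
    then show ?thesis
    proof cases
      case 2
      then show ?thesis
        using convex_inD[OF that(1) that(6) that(3) that(8)] by blast
    next
      case 3
      then show ?thesis
        using convex_inD[OF that(2) that(4) that(7) _ that(9)] by blast
    qed (use that in blast)
  qed
  fix x z y assume xz: "x \<in> C \<union> D" "z \<in> C \<union> D" "x \<lessdot> y \<and> y \<lessdot> z"
  have "w \<in> K" using assms by blast
  with xz show "y \<in> C \<union> D"
    using *[OF assms(1,1,5,5)] *[OF assms(1,2,5,6)] *[OF assms(2,1,6,5)] *[OF assms(2,2,6,6)] by blast
qed

end

context ordered_topology
begin

text \<open>Open convex sets that avoid \<open>F\<close> and lie on one side of every clopen final segment. Overlapping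
  admissible sets have an admissible union, so each point of an admissible set lies in a largest one, its cell.\<close>

definition admissible :: "'a set \<Rightarrow> 'a set \<Rightarrow> bool" where
  "admissible F C \<longleftrightarrow> openin L C \<and> convex_in C \<and> C \<inter> F = {} \<and>
     (\<forall>T\<in>upper_cuts. C \<subseteq> T \<or> C \<inter> T = {})"

lemma admissible_Un:
  assumes "admissible F C" "admissible F D" "w \<in> C" "w \<in> D"
  shows "admissible F (C \<union> D)"
proof -
  have "convex_in (C \<union> D)"
    using assms by (intro convex_Un[of C D w] open_subset) (simp_all add: admissible_def)
  moreover have "C \<union> D \<subseteq> T \<or> (C \<union> D) \<inter> T = {}" if "T \<in> upper_cuts" for T
  proof -
    have "C \<subseteq> T \<or> C \<inter> T = {}" "D \<subseteq> T \<or> D \<inter> T = {}"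
      using assms(1,2) that unfolding admissible_def by blast+
    then show ?thesis using assms(3,4) by blast
  qed
  ultimately show ?thesis
    using assms unfolding admissible_def by (simp add: Int_Un_distrib2 openin_Un)
qed

definition cell :: "'a set \<Rightarrow> 'a \<Rightarrow> 'a set" where
  "cell F x = \<Union>{C. admissible F C \<and> x \<in> C}"

lemma cell_maximal: "admissible F C \<Longrightarrow> x \<in> C \<Longrightarrow> C \<subseteq> cell F x"
  unfolding cell_def by blast

lemma admissible_cell: "admissible F (cell F x)"
proof -
  have "convex_in (cell F x)"
    unfolding convex_in_def
  proof (intro ballI allI impI)
    fix a b c assume "a \<in> cell F x" "b \<in> cell F x" and ac: "a \<lessdot> c \<and> c \<lessdot> b"
    then obtain C where "admissible F C" "x \<in> C" "a \<in> C"
      unfolding cell_def by blast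
    moreover obtain D where "admissible F D" "x \<in> D" "b \<in> D"
      using \<open>b \<in> cell F x\<close> unfolding cell_def by blast
    ultimately have CD: "admissible F C" "x \<in> C" "a \<in> C" "admissible F D" "x \<in> D" "b \<in> D"
      by simp_all
    have un: "admissible F (C \<union> D)"
      by (rule admissible_Un[OF CD(1,4,2,5)])
    have "c \<in> C \<union> D"
      using convex_inD[of "C \<union> D" a b c] un CD(3,6) ac unfolding admissible_def by blast
    then show "c \<in> cell F x"
      using cell_maximal[OF un, of x] CD by blast
  qed
  moreover have "openin L (cell F x)"
    unfolding cell_def by (rule openin_Union) (simp add: admissible_def)
  moreover have "cell F x \<inter> F = {}"
    unfolding cell_def admissible_def by blast
  moreover have "cell F x \<subseteq> T \<or> cell F x \<inter> T = {}" if "T \<in> upper_cuts" for T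
  proof -
    have "C \<subseteq> T \<or> C \<inter> T = {}" if "admissible F C" for C
      using that \<open>T \<in> upper_cuts\<close> unfolding admissible_def by blast
    then show ?thesis
      unfolding cell_def by (cases "x \<in> T") blast+
  qed
  ultimately show ?thesis
    unfolding admissible_def by blast
qed

lemma cell_eq:
  assumes "w \<in> cell F x" "w \<in> cell F y"
  shows "cell F x = cell F y"
proof -
  have un: "admissible F (cell F x \<union> cell F y)"
    by (rule admissible_Un[OF admissible_cell admissible_cell assms])
  have "x \<in> cell F x" "y \<in> cell F y"
    using assms unfolding cell_def by blast+
  then show ?thesis
    using cell_maximal[OF un] by blast
qed

text \<open>The points without any admissible neighbourhood, that is, those whose neighbourhoods are all cut by
  clopen final segments. A closed set \<open>F\<close> containing them leaves a cell around each point outside \<open>F\<close>.\<close>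

definition undecided :: "'a set" where
  "undecided = K - \<Union>{C. admissible {} C}"

definition cells :: "'a set \<Rightarrow> 'a set set" where
  "cells F = cell F ` (K - F)"

lemma closedin_undecided: "closedin L undecided"
proof -
  have "openin L (\<Union>{C. admissible {} C})"
    by (rule openin_Union) (simp add: admissible_def)
  then show ?thesis
    unfolding undecided_def using closedin_diff[OF closedin_topspace, of L] topspace_L by simp
qed

lemma in_cell:
  assumes "closedin L F" "undecided \<subseteq> F" "x \<in> K - F"
  shows "x \<in> cell F x"
proof -
  obtain C where C: "admissible {} C" "x \<in> C"
    using assms unfolding undecided_def by blast
  have "openin L (C \<inter> (K - F))"
    using C(1) assms(1) openin_Int[of L C "K - F"] topspace_L
    unfolding admissible_def closedin_def by simp
  then obtain H where H: "openin L H" "x \<in> H" "H \<subseteq> C \<inter> (K - F)" "convex_in H"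
    using convex_base C(2) assms(3) by blast
  then have "admissible F H"
    using C(1) unfolding admissible_def by blast
  then show ?thesis
    using cell_maximal H(2) by blast
qed

end

text \<open>Relatively discrete sets: discrete in the subspace topology, not necessarily closed.\<close>

definition relatively_discrete :: "'a topology \<Rightarrow> 'a set \<Rightarrow> bool" where
  "relatively_discrete X A \<longleftrightarrow> (\<forall>a\<in>A. \<exists>U. openin X U \<and> U \<inter> A = {a})"

text \<open>Sets that are nowhere dense within an open set \<open>I\<close>.\<close>

definition thin_in :: "'a topology \<Rightarrow> 'a set \<Rightarrow> 'a set \<Rightarrow> bool" where
  "thin_in X I A \<longleftrightarrow> (\<forall>W. openin X W \<and> W \<subseteq> I \<and> W \<noteq> {} \<longrightarrow>
     (\<exists>W'. openin X W' \<and> W' \<subseteq> W \<and> W' \<noteq> {} \<and> W' \<inter> A = {}))"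

lemma thin_in_Un:
  assumes "thin_in X I A" "thin_in X I B"
  shows "thin_in X I (A \<union> B)"
  unfolding thin_in_def
proof (intro allI impI)
  fix W assume "openin X W \<and> W \<subseteq> I \<and> W \<noteq> {}"
  then obtain V where V: "openin X V" "V \<subseteq> W" "V \<noteq> {}" "V \<inter> A = {}" "V \<subseteq> I"
    using assms(1) unfolding thin_in_def by (meson subset_trans)
  then obtain U where "openin X U" "U \<subseteq> V" "U \<noteq> {}" "U \<inter> B = {}"
    using assms(2) unfolding thin_in_def by meson
  then show "\<exists>W'. openin X W' \<and> W' \<subseteq> W \<and> W' \<noteq> {} \<and> W' \<inter> (A \<union> B) = {}"
    using V by (intro exI[of _ U]) auto
qed

lemma thin_in_closure_relatively_discrete:
  assumes A: "relatively_discrete X A" and t1: "t1_space X"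
    and crowded: "\<And>w. w \<in> I \<Longrightarrow> \<not> openin X {w}"
  shows "thin_in X I (X closure_of A)"
  unfolding thin_in_def
proof (intro allI impI)
  fix W assume W: "openin X W \<and> W \<subseteq> I \<and> W \<noteq> {}"
  show "\<exists>W'. openin X W' \<and> W' \<subseteq> W \<and> W' \<noteq> {} \<and> W' \<inter> X closure_of A = {}"
  proof (cases "W \<inter> A = {}")
    case True
    then show ?thesis
      using W by (intro exI[of _ W]) (simp add: openin_Int_closure_of_eq_empty)
  next
    case False
    then obtain a where a: "a \<in> W" "a \<in> A"
      by blast
    then obtain U where U: "openin X U" "U \<inter> A = {a}"
      using A unfolding relatively_discrete_def by blast
    define W' where "W' = W \<inter> U - {a}"
    have "openin X (W \<inter> U)"
      using W U by blast
    then have open_W': "openin X W'"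
      using t1 unfolding W'_def t1_space_openin_delete_alt by blast
    moreover have "W' \<noteq> {}"
    proof
      assume "W' = {}"
      then have "W \<inter> U = {a}"
        using a U(2) unfolding W'_def by blast
      then show False
        using \<open>openin X (W \<inter> U)\<close> crowded[of a] a(1) W by auto
    qed
    moreover have "W' \<inter> A = {}"
      using U(2) unfolding W'_def by blast
    then have "W' \<inter> X closure_of A = {}"
      using open_W' by (simp add: openin_Int_closure_of_eq_empty)
    ultimately show ?thesis
      unfolding W'_def by blast
  qed
qed

context ordered_topology
begin

text \<open>An arbitrary point of a non-empty set.\<close>

definition chosen :: "'a set \<Rightarrow> 'a" where
  "chosen V = (SOME x. x \<in> V)"

text \<open>The first barrier consists of the undecided points. Each further one extends its predecessor by the
  closures of one of the given discrete sets and of the set of points chosen in the cells that the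
  predecessor leaves.\<close>

primrec barrier :: "(nat \<Rightarrow> 'a set) \<Rightarrow> nat \<Rightarrow> 'a set" where
  "barrier D 0 = undecided"
| "barrier D (Suc n) = barrier D n \<union> L closure_of (D n) \<union> L closure_of (chosen ` cells (barrier D n))"

lemma closedin_barrier: "closedin L (barrier D n)"
  by (induction n) (simp_all add: closedin_undecided closedin_Un)

lemma barrier_mono:
  assumes "m \<le> n"
  shows "barrier D m \<subseteq> barrier D n"
  by (rule lift_Suc_mono_le[OF _ assms]) (simp add: Un_assoc)

lemma undecided_subset_barrier: "undecided \<subseteq> barrier D n"
  using barrier_mono[of 0 n D] by (simp only: barrier.simps le0)

lemma chosen_in_cell:
  assumes "V \<in> cells (barrier D n)"
  shows "chosen V \<in> V"
proof -
  obtain x where "x \<in> K - barrier D n" "V = cell (barrier D n) x"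
    using assms unfolding cells_def by blast
  then have "x \<in> V"
    using in_cell[OF closedin_barrier undecided_subset_barrier] by blast
  then show ?thesis
    unfolding chosen_def by (rule someI)
qed

lemma admissible_cells: "V \<in> cells F \<Longrightarrow> admissible F V"
  unfolding cells_def by (erule imageE) (simp only: admissible_cell)

lemma cells_disjoint:
  assumes "V \<in> cells F" "W \<in> cells F" "V \<noteq> W"
  shows "V \<inter> W = {}"
proof -
  obtain x y where "V = cell F x" "W = cell F y"
    using assms(1,2) unfolding cells_def by blast
  then show ?thesis
    using cell_eq[of _ F x y] assms(3) by blast
qed

lemma relatively_discrete_chosen: "relatively_discrete L (chosen ` cells (barrier D n))"
  unfolding relatively_discrete_def
proof
  fix a assume "a \<in> chosen ` cells (barrier D n)"
  then obtain V where V: "V \<in> cells (barrier D n)" "a = chosen V"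
    by blast
  have "V \<inter> chosen ` cells (barrier D n) = {a}"
  proof
    show "V \<inter> chosen ` cells (barrier D n) \<subseteq> {a}"
    proof
      fix b assume b: "b \<in> V \<inter> chosen ` cells (barrier D n)"
      then obtain W where W: "W \<in> cells (barrier D n)" "b = chosen W"
        by blast
      then have "V = W"
        using cells_disjoint[OF V(1) W(1)] chosen_in_cell[OF W(1)] b by blast
      then show "b \<in> {a}" using V W by simp
    qed
    show "{a} \<subseteq> V \<inter> chosen ` cells (barrier D n)"
      using V chosen_in_cell[OF V(1)] by blast
  qed
  then show "\<exists>U. openin L U \<and> U \<inter> chosen ` cells (barrier D n) = {a}"
    using admissible_cells[OF V(1)] unfolding admissible_def by blast
qed

lemma t1_L: "t1_space L"
  unfolding t1_space_openin_delete_alt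
proof (intro allI impI)
  fix U x assume U: "openin L U"
  show "openin L (U - {x})"
  proof (cases "x \<in> U")
    case True
    then have xK: "x \<in> K"
      using U open_subset by blast
    have "U - {x} = U \<inter> ({y. x \<lessdot> y} \<union> {y. y \<lessdot> x})"
      using lt_linear[OF xK] lt_irrefl open_subset[OF U] by blast
    then show ?thesis
      using U open_above open_below by (simp add: openin_Int openin_Un)
  qed (use U in simp)
qed

lemma upper_cut_at:
  assumes "T = {z. x \<lessdot> z} \<union> E" "openin L T" "K - T = {z. z \<lessdot> y}" "\<And>e. e \<in> E \<Longrightarrow> e = x"
  shows "T \<in> upper_cuts"
proof -
  have "z \<in> T" if "w \<in> T" "w \<lessdot> z" for w z
  proof -
    have "x \<lessdot> z"
      using that assms(1,4) lt_trans by blast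
    then show ?thesis using assms(1) by blast
  qed
  then show ?thesis
    unfolding upper_cuts_def using assms(2,3) open_below[of y] by auto
qed

text \<open>Two points that no clopen final segment separates span an interval that is densely ordered and has no
  isolated points.\<close>

lemma dense_between:
  assumes xy: "\<forall>T\<in>upper_cuts. x \<in> T \<or> y \<notin> T"
    and "x = a \<or> x \<lessdot> a" "b = y \<or> b \<lessdot> y" "a \<lessdot> b"
  shows "\<exists>z. a \<lessdot> z \<and> z \<lessdot> b"
proof (rule ccontr)
  assume none: "\<not> ?thesis"
  have ab: "a \<in> K" "b \<in> K"
    using assms(4) lt_carrier by blast+
  have "K - {z. a \<lessdot> z} = {z. z \<lessdot> b}"
  proof (rule set_eqI)
    fix z
    show "z \<in> K - {z. a \<lessdot> z} \<longleftrightarrow> z \<in> {z. z \<lessdot> b}"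
      using none assms(4) lt_linear[OF ab(1), of z] lt_trans[of z a b] lt_carrier[of z b] by blast
  qed
  then have "{z. a \<lessdot> z} \<in> upper_cuts"
    by (intro upper_cut_at[of _ a "{}" b]) (simp_all add: open_above)
  moreover have "\<not> a \<lessdot> x"
    using assms(2) lt_asym lt_irrefl by blast
  moreover have "a \<lessdot> y"
    using assms(3,4) lt_trans by blast
  ultimately show False
    using xy by blast
qed

lemma no_isolated_between:
  assumes xy: "\<forall>T\<in>upper_cuts. x \<in> T \<or> y \<notin> T" and w: "x \<lessdot> w" "w \<lessdot> y"
  shows "\<not> openin L {w}"
proof
  assume iso: "openin L {w}"
  have wK: "w \<in> K"
    using w lt_carrier by blast
  have "K - ({z. w \<lessdot> z} \<union> {w}) = {z. z \<lessdot> w}"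
    using lt_linear[OF wK] lt_asym lt_irrefl lt_carrier by blast
  then have cut: "{z. w \<lessdot> z} \<union> {w} \<in> upper_cuts"
    by (rule upper_cut_at[OF refl openin_Un[OF open_above iso]]) simp
  show False
    using bspec[OF xy cut] w lt_asym[OF w(1)] lt_irrefl[of w] by simp
qed

text \<open>In an interval spanned by points that no clopen final segment separates, the barriers are nowhere
  dense. Once a barrier contains two points \<open>a < b\<close> of the interval, any cell that it leaves between them
  cannot extend beyond \<open>a\<close> and \<open>b\<close>.\<close>

lemma cell_between:
  assumes xy: "x \<lessdot> y" "\<forall>T\<in>upper_cuts. x \<in> T \<or> y \<notin> T"
    and D: "\<And>n. relatively_discrete L (D n)" "L closure_of (\<Union>n. D n) = K" "\<And>n. D n \<subseteq> K"
  shows "\<exists>n. \<exists>V\<in>cells (barrier D n). \<forall>v\<in>V. x \<lessdot> v \<and> v \<lessdot> y"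
proof -
  define I where "I = {z. x \<lessdot> z \<and> z \<lessdot> y}"
  have thin_closure: "thin_in L I (L closure_of A)" if "relatively_discrete L A" for A
    by (rule thin_in_closure_relatively_discrete[OF that t1_L])
      (simp add: I_def no_isolated_between[OF xy(2)])
  have "admissible {} I"
    unfolding admissible_def
  proof (intro conjI ballI)
    show "openin L I"
      unfolding I_def by (rule open_interval)
    show "convex_in I"
      unfolding I_def convex_in_def using lt_trans by blast
    show "I \<subseteq> T \<or> I \<inter> T = {}" if T: "T \<in> upper_cuts" for T
    proof (cases "x \<in> T")
      case True
      then show ?thesis using T unfolding upper_cuts_def I_def by blast
    next
      case False
      then have "y \<notin> T" using xy(2) T by blast
      then show ?thesis using T unfolding upper_cuts_def I_def by blast
    qed
  qed simp
  then have "I \<inter> undecided = {}"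
    unfolding undecided_def by blast
  then have "thin_in L I undecided"
    unfolding thin_in_def by blast
  then have thin: "thin_in L I (barrier D n)" for n
    by (induction n) (simp_all add: thin_in_Un thin_closure D(1) relatively_discrete_chosen)
  have meets: "\<exists>n. \<exists>d\<in>D n. a \<lessdot> d \<and> d \<lessdot> b" if ab: "\<exists>z. a \<lessdot> z \<and> z \<lessdot> b" for a b
  proof -
    have "{z. a \<lessdot> z \<and> z \<lessdot> b} \<inter> L closure_of (\<Union>n. D n) \<noteq> {}"
      using ab lt_carrier unfolding D(2) by blast
    then have "{z. a \<lessdot> z \<and> z \<lessdot> b} \<inter> (\<Union>n. D n) \<noteq> {}"
      using openin_Int_closure_of_eq_empty[OF open_interval] by blast
    then show ?thesis by blast
  qed
  have between: "\<exists>z. a \<lessdot> z \<and> z \<lessdot> b" if "x = a \<or> x \<lessdot> a" "b = y \<or> b \<lessdot> y" "a \<lessdot> b" for a b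
    by (rule dense_between[OF xy(2) that])
  have mem_barrier: "d \<in> barrier D (Suc n)" if "d \<in> D n" for d n
  proof -
    have "d \<in> L closure_of (D n)"
      using closure_of_subset[of "D n" L] D(3)[of n] topspace_L that by blast
    then show ?thesis by simp
  qed
  obtain i a where a: "a \<in> D i" "x \<lessdot> a" "a \<lessdot> y"
    using meets[OF between[OF _ _ xy(1)]] by blast
  obtain j b where b: "b \<in> D j" "a \<lessdot> b" "b \<lessdot> y"
    using meets[OF between[OF _ _ a(3)]] a(2) by blast
  define n where "n = Suc (max i j)"
  have ab: "a \<in> barrier D n" "b \<in> barrier D n"
    using mem_barrier[OF a(1)] mem_barrier[OF b(1)] barrier_mono[of "Suc i" n D] barrier_mono[of "Suc j" n D]
    unfolding n_def by auto
  have "{z. a \<lessdot> z \<and> z \<lessdot> b} \<noteq> {}"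
    using between[OF _ _ b(2)] a(2) b(3) by blast
  moreover have "{z. a \<lessdot> z \<and> z \<lessdot> b} \<subseteq> I"
    using a(2) b(3) lt_trans unfolding I_def by blast
  ultimately obtain W where W: "W \<subseteq> {z. a \<lessdot> z \<and> z \<lessdot> b}" "W \<noteq> {}" "W \<inter> barrier D n = {}"
    using thin[of n] open_interval unfolding thin_in_def by meson
  then obtain w where w: "a \<lessdot> w" "w \<lessdot> b" "w \<in> K - barrier D n"
    using lt_carrier by blast
  define V where "V = cell (barrier D n) w"
  have V: "V \<in> cells (barrier D n)"
    unfolding V_def cells_def using w by blast
  have wV: "w \<in> V"
    unfolding V_def by (rule in_cell[OF closedin_barrier undecided_subset_barrier w(3)])
  have conv: "convex_in V" and sub: "V \<subseteq> K" and avoid: "a \<notin> V" "b \<notin> V"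
    using admissible_cells[OF V] ab open_subset unfolding admissible_def by blast+
  have "a \<lessdot> v \<and> v \<lessdot> b" if v: "v \<in> V" for v
  proof -
    have "\<forall>v\<in>V. a \<lessdot> v"
      using convex_side[OF conv sub _ avoid(1)] lt_carrier[OF w(1)] lt_asym[OF w(1)] wV by blast
    moreover have "\<forall>v\<in>V. v \<lessdot> b"
      using convex_side[OF conv sub _ avoid(2)] lt_carrier[OF w(2)] lt_asym[OF w(2)] wV by blast
    ultimately show ?thesis using v by blast
  qed
  then have "x \<lessdot> v \<and> v \<lessdot> y" if "v \<in> V" for v
    using that lt_trans[OF a(2)] lt_trans[OF _ b(3)] by blast
  then show ?thesis
    using V by blast
qed

end

section \<open>Weight\<close>

text \<open>Adding at most \<open>|B|\<close> generators to a topology with an infinite base \<open>B\<close> does not increase the size of a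
  base.\<close>

lemma base_of_generated:
  fixes L M :: "'a topology" and B \<G> :: "'a set set"
  assumes M: "M = topology_generated_by ({G. openin L G} \<union> \<G>)" and B: "is_base L B"
    and inf: "infinite B" and card: "|\<G>| \<le>o |B|" and sub: "\<And>G. G \<in> \<G> \<Longrightarrow> G \<subseteq> topspace L"
  shows "\<exists>B'. is_base M B' \<and> |B'| \<le>o |B|"
proof -
  define \<H> where "\<H> = insert (topspace L) (B \<union> \<G>)"
  \<comment> \<open>\<open>Q n\<close> consists of the intersections of \<open>n + 1\<close> members of \<open>\<H>\<close>.\<close>
  define Q where "Q = rec_nat \<H> (\<lambda>_ A. (\<lambda>(C, D). C \<inter> D) ` (A \<times> \<H>))"
  have Q: "Q 0 = \<H>" "Q (Suc n) = (\<lambda>(C, D). C \<inter> D) ` (Q n \<times> \<H>)" for n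
    by (simp_all add: Q_def)
  have inf': "infinite (Field |B| )"
    using inf unfolding Field_card_of .
  have "B \<noteq> {}"
    using inf finite.emptyI by blast
  then have "|{topspace L}| \<le>o |B|"
    by (rule card_of_singl_ordLeq)
  moreover have "|B \<union> \<G>| \<le>o |B|"
    by (rule card_of_Un_ordLeq_infinite_Field[OF inf' ordLeq_refl card card_of_Card_order])
      (rule card_of_Card_order)
  ultimately have "|{topspace L} \<union> (B \<union> \<G>)| \<le>o |B|"
    by (rule card_of_Un_ordLeq_infinite_Field[OF inf' _ _ card_of_Card_order])
  then have card_H: "|\<H>| \<le>o |B|"
    by (simp only: \<H>_def insert_is_Un[symmetric])
  have card_Q: "|Q n| \<le>o |B|" for n
  proof (induction n)
    case (Suc n)
    have "|Q n \<times> \<H>| \<le>o |B|"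
      by (rule card_of_Times_ordLeq_infinite_Field[OF inf' Suc card_H card_of_Card_order])
    then show ?case
      unfolding Q by (rule ordLeq_transitive[OF card_of_image])
  qed (simp add: Q card_H)
  define B' where "B' = (\<Union>n. Q n)"
  have "|B'| \<le>o |B|"
    unfolding B'_def
    by (rule card_of_UNION_ordLeq_infinite[OF inf infinite_iff_card_of_nat[THEN iffD1, OF inf]])
      (use card_Q in blast)
  moreover have "is_base M B'"
    unfolding is_base_def openin_topology_base_unique
  proof (intro conjI allI ballI impI)
    have H_open: "openin M C" if "C \<in> \<H>" for C
    proof -
      have "openin L C" if "C \<in> B" for C
        using B that unfolding is_base_def openin_topology_base_unique by blast
      then have "C \<in> {G. openin L G} \<union> \<G>"
        using that unfolding \<H>_def by blast
      then show ?thesis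
        unfolding M by (rule topology_generated_by_Basis)
    qed
    have Q_open: "openin M C" if "C \<in> Q n" for C n
      using that by (induction n arbitrary: C) (auto simp: Q H_open)
    then show "openin M C" if "C \<in> B'" for C
      using that unfolding B'_def by blast
    have B'_Int: "A \<inter> C \<in> B'" if A: "A \<in> B'" and "C \<in> Q n" for A C n
      using that(2)
    proof (induction n arbitrary: C)
      case 0
      obtain m where "A \<in> Q m"
        using A unfolding B'_def by blast
      then have "A \<inter> C \<in> Q (Suc m)"
        using 0 unfolding Q by blast
      then show ?case unfolding B'_def by blast
    next
      case (Suc n)
      then obtain D E where C: "D \<in> Q n" "E \<in> \<H>" "C = D \<inter> E"
        unfolding Q by auto
      obtain m where "A \<inter> D \<in> Q m"
        using Suc.IH[OF C(1)] unfolding B'_def by blast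
      then have "(A \<inter> D) \<inter> E \<in> Q (Suc m)"
        using C(2) unfolding Q by blast
      then show ?case unfolding B'_def C(3) Int_assoc by blast
    qed
    have fine: "\<forall>x\<in>U. \<exists>V\<in>B'. x \<in> V \<and> V \<subseteq> U" if "generate_topology_on ({G. openin L G} \<union> \<G>) U" for U
      using that
    proof induction
      case (Int U W)
      show ?case
      proof
        fix x assume "x \<in> U \<inter> W"
        then obtain V V' where V: "V \<in> B'" "x \<in> V" "V \<subseteq> U" and V': "V' \<in> B'" "x \<in> V'" "V' \<subseteq> W"
          using Int.IH by (meson IntD1 IntD2)
        obtain n where "V' \<in> Q n"
          using V'(1) unfolding B'_def by blast
        then have "V \<inter> V' \<in> B'"
          by (rule B'_Int[OF V(1)])
        then show "\<exists>V\<in>B'. x \<in> V \<and> V \<subseteq> U \<inter> W"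
          using V V' by (intro bexI[of _ "V \<inter> V'"]) auto
      qed
    next
      case (UN \<K>)
      show ?case
      proof
        fix x assume "x \<in> \<Union>\<K>"
        then obtain k where k: "k \<in> \<K>" "x \<in> k"
          by blast
        then obtain V where "V \<in> B'" "x \<in> V" "V \<subseteq> k"
          using UN.IH[OF k(1)] by blast
        then show "\<exists>V\<in>B'. x \<in> V \<and> V \<subseteq> \<Union>\<K>"
          using k(1) by blast
      qed
    next
      case (Basis U)
      have H_B': "\<H> \<subseteq> B'"
        unfolding B'_def using Q(1) by blast
      show ?case
      proof (cases "U \<in> \<G>")
        case True
        then show ?thesis using H_B' unfolding \<H>_def by blast
      next
        case False
        then have "openin L U" using Basis by blast
        then have "\<exists>V\<in>B. x \<in> V \<and> V \<subseteq> U" if "x \<in> U" for x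
          using B that unfolding is_base_def openin_topology_base_unique by blast
        then show ?thesis using H_B' unfolding \<H>_def by blast
      qed
    qed simp
    show "\<exists>V. V \<in> B' \<and> x \<in> V \<and> V \<subseteq> U" if "openin M U \<and> x \<in> U" for U x
    proof -
      have "generate_topology_on ({G. openin L G} \<union> \<G>) U"
        using that openin_topology_generated_by unfolding M by blast
      then show ?thesis using fine that by blast
    qed
  qed
  ultimately show ?thesis by blast
qed

lemma card_disjoint_open_le_base:
  assumes B: "is_base L B" and disj: "\<And>V W. V \<in> \<U> \<Longrightarrow> W \<in> \<U> \<Longrightarrow> V \<noteq> W \<Longrightarrow> V \<inter> W = {}"
    and open_ne: "\<And>V. V \<in> \<U> \<Longrightarrow> openin L V \<and> V \<noteq> {}"
  shows "|\<U>| \<le>o |B|"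
proof -
  have "\<exists>b\<in>B. b \<noteq> {} \<and> b \<subseteq> V" if V: "V \<in> \<U>" for V
  proof -
    obtain x where "x \<in> V" using open_ne[OF V] by blast
    then show ?thesis
      using B open_ne[OF V] unfolding is_base_def openin_topology_base_unique by (metis empty_iff)
  qed
  then obtain b where b: "\<And>V. V \<in> \<U> \<Longrightarrow> b V \<in> B \<and> b V \<noteq> {} \<and> b V \<subseteq> V"
    by metis
  have "inj_on b \<U>"
  proof (rule inj_onI)
    fix V W assume VW: "V \<in> \<U>" "W \<in> \<U>" "b V = b W"
    then have "b V \<subseteq> V \<inter> W" "b V \<noteq> {}"
      using b[OF VW(1)] b[OF VW(2)] by auto
    then show "V = W"
      using disj[OF VW(1,2)] by blast
  qed
  moreover have "b ` \<U> \<subseteq> B"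
    using b by blast
  ultimately show ?thesis
    using card_of_ordLeq by blast
qed

lemma finite_base_imp_finite:
  assumes t1: "t1_space L" and B: "is_base L B" and fin: "finite B"
  shows "finite (topspace L)"
proof -
  have "inj_on (\<lambda>x. {b \<in> B. x \<in> b}) (topspace L)"
  proof (rule inj_onI, rule ccontr)
    fix x y assume xy: "x \<in> topspace L" "y \<in> topspace L" "{b \<in> B. x \<in> b} = {b \<in> B. y \<in> b}" "x \<noteq> y"
    then obtain U where "openin L U" "x \<in> U" "y \<notin> U"
      using t1 unfolding t1_space_def by blast
    then obtain b where "b \<in> B" "x \<in> b" "b \<subseteq> U"
      using B unfolding is_base_def openin_topology_base_unique by blast
    then show False
      using xy(3) \<open>y \<notin> U\<close> by blast
  qed
  moreover have "(\<lambda>x. {b \<in> B. x \<in> b}) ` topspace L \<subseteq> Pow B"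
    by blast
  ultimately show ?thesis
    using fin by (meson finite_Pow_iff finite_imageD finite_subset)
qed

section \<open>The refinement\<close>

context ordered_topology
begin

text \<open>A clopen neighbourhood in \<open>X\<close> of the point over \<open>q\<close> perturbs the final segment above \<open>q\<close> to a set whose
  preimage is clopen.\<close>

lemma clopen_cut:
  fixes X :: "'c topology"
  assumes X: "X dim_le 0" and f: "continuous_bijection X L f"
    and V: "openin L V" "convex_in V" "q \<in> V"
  shows "\<exists>S. above V \<subseteq> S \<and> S \<subseteq> above V \<union> V \<and>
             openin X {x \<in> topspace X. f x \<in> S} \<and> openin X {x \<in> topspace X. f x \<in> K - S}"
proof -
  have cont: "continuous_map X L f" and bij: "bij_betw f (topspace X) K"
    using f topspace_L unfolding continuous_bijection_def by simp_all
  have VK: "V \<subseteq> K"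
    using V(1) by (rule open_subset)
  obtain x0 where x0: "x0 \<in> topspace X" "f x0 = q"
    using bij V(3) VK unfolding bij_betw_def by blast
  have "openin X {x \<in> topspace X. f x \<in> V}"
    using cont V(1) by (rule openin_continuous_map_preimage)
  moreover have "x0 \<in> {x \<in> topspace X. f x \<in> V}"
    using x0 V(3) by simp
  ultimately obtain U N where N: "x0 \<in> U" "U \<subseteq> N" "closedin X N" "openin X N" "N \<subseteq> {x \<in> topspace X. f x \<in> V}"
    using X unfolding dimension_le_0_neighbourhood_base_of_clopen neighbourhood_base_of by meson
  define S where "S = {y. q \<lessdot> y} \<union> f ` N"
  have q: "q \<in> f ` N" "q \<in> K"
    using N x0 V VK by blast+
  have preimage: "f x \<in> S \<longleftrightarrow> q \<lessdot> f x \<or> x \<in> N" if "x \<in> topspace X" for x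
    using that bij N(5) unfolding S_def bij_betw_def inj_on_def by blast
  have "above V \<subseteq> S"
    using V(3) unfolding above_def S_def by blast
  moreover have "y \<in> above V \<union> V" if "q \<lessdot> y" for y
    using convex_side[OF V(2) VK, of y] lt_carrier[OF that] lt_asym[OF that] V(3) unfolding above_def by blast
  then have "S \<subseteq> above V \<union> V"
    using N(5) unfolding S_def by blast
  moreover have "{x \<in> topspace X. f x \<in> S} = {x \<in> topspace X. f x \<in> {y. q \<lessdot> y}} \<union> N"
    using preimage N(5) by blast
  then have "openin X {x \<in> topspace X. f x \<in> S}"
    using openin_Un[OF openin_continuous_map_preimage[OF cont open_above] N(4)] by simp
  moreover have "{x \<in> topspace X. f x \<in> K - S} = {x \<in> topspace X. f x \<in> {y. y \<lessdot> q}} - N"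
  proof (rule set_eqI)
    fix x
    have "f x \<in> K - S \<longleftrightarrow> f x \<lessdot> q \<and> x \<notin> N" if x: "x \<in> topspace X"
    proof -
      have "f x \<in> K"
        using bij x unfolding bij_betw_def by blast
      moreover have "f x \<noteq> q" if "x \<notin> N"
        using preimage[OF x] q(1) that lt_irrefl unfolding S_def by auto
      ultimately show ?thesis
        using preimage[OF x] lt_linear[OF q(2), of "f x"] lt_asym[of q "f x"] by blast
    qed
    then show "x \<in> {x \<in> topspace X. f x \<in> K - S} \<longleftrightarrow> x \<in> {x \<in> topspace X. f x \<in> {y. y \<lessdot> q}} - N"
      by blast
  qed
  then have "openin X {x \<in> topspace X. f x \<in> K - S}"
    using openin_diff[OF openin_continuous_map_preimage[OF cont open_below] N(3)] by simp
  ultimately show ?thesis by blast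
qed

lemma chosen_avoids_later_cells:
  assumes V: "V \<in> cells (barrier D m)" and W: "W \<in> cells (barrier D n)" and "m < n"
  shows "chosen V \<notin> W"
proof -
  have "chosen ` cells (barrier D m) \<subseteq> K"
    using chosen_in_cell admissible_cells open_subset unfolding admissible_def by blast
  then have "chosen V \<in> L closure_of (chosen ` cells (barrier D m))"
    using closure_of_subset[of "chosen ` cells (barrier D m)" L] V topspace_L by blast
  then have "chosen V \<in> barrier D n"
    using barrier_mono[of "Suc m" n D] \<open>m < n\<close> by auto
  then show ?thesis
    using admissible_cells[OF W] unfolding admissible_def by blast
qed

lemma zero_dimensional_GO_refinement:
  fixes X :: "'c topology" and D :: "nat \<Rightarrow> 'a set"
  assumes X: "X dim_le 0" and f: "continuous_bijection X L f" and haus: "Hausdorff_space L"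
    and D: "\<And>n. relatively_discrete L (D n)" "L closure_of (\<Union>n. D n) = K" "\<And>n. D n \<subseteq> K"
    and B: "is_base L B" "infinite B"
  shows "\<exists>M B'. GO_space M \<and> M dim_le 0 \<and> Hausdorff_space M \<and> is_base M B' \<and> |B'| \<le>o |B| \<and>
           continuous_bijection X M f \<and> continuous_bijection M L id"
proof -
  define \<U> where "\<U> n = cells (barrier D n)" for n
  have cell: "openin L V" "convex_in V" "chosen V \<in> V" "V \<subseteq> K" if "V \<in> \<U> n" for V n
  proof -
    show "openin L V" "convex_in V"
      using admissible_cells that unfolding \<U>_def admissible_def by blast+
    then show "V \<subseteq> K"
      by (simp add: open_subset)
    show "chosen V \<in> V"
      using chosen_in_cell that unfolding \<U>_def by blast
  qed
  have "\<forall>V\<in>(\<Union>n. \<U> n). \<exists>S. above V \<subseteq> S \<and> S \<subseteq> above V \<union> V \<and>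
          openin X {x \<in> topspace X. f x \<in> S} \<and> openin X {x \<in> topspace X. f x \<in> K - S}"
  proof
    fix V assume "V \<in> (\<Union>n. \<U> n)"
    then obtain n where "V \<in> \<U> n"
      by blast
    then show "\<exists>S. above V \<subseteq> S \<and> S \<subseteq> above V \<union> V \<and>
          openin X {x \<in> topspace X. f x \<in> S} \<and> openin X {x \<in> topspace X. f x \<in> K - S}"
      by (intro clopen_cut[OF X f cell(1-3)])
  qed
  then obtain S where "\<forall>V\<in>(\<Union>n. \<U> n). above V \<subseteq> S V \<and> S V \<subseteq> above V \<union> V \<and>
          openin X {x \<in> topspace X. f x \<in> S V} \<and> openin X {x \<in> topspace X. f x \<in> K - S V}"
    by (rule bchoice[THEN exE])
  then have S: "above V \<subseteq> S V" "S V \<subseteq> above V \<union> V" "openin X {x \<in> topspace X. f x \<in> S V}"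
      "openin X {x \<in> topspace X. f x \<in> K - S V}" if "V \<in> \<U> n" for V n
    using that by blast+
  have S_sub: "S V \<subseteq> K" if "V \<in> \<U> n" for V n
    using S(2)[OF that] cell(4)[OF that] unfolding above_def by blast
  define \<G> where "\<G> = (\<Union>n. S ` \<U> n \<union> (\<lambda>V. K - S V) ` \<U> n)"
  have \<G>_sub: "G \<subseteq> topspace L" if "G \<in> \<G>" for G
    using that S_sub topspace_L unfolding \<G>_def by blast
  define M where "M = topology_generated_by ({G. openin L G} \<union> \<G>)"
  have K_M: "topspace M = K"
    unfolding M_def using \<G>_sub open_subset openin_topspace[of L] topspace_L by auto
  have M_open: "openin M G" if "openin L G \<or> G \<in> \<G>" for G
    unfolding M_def using that by (intro topology_generated_by_Basis) simp
  interpret cs: cut_system K "(\<lessdot>)" L M \<U> chosen S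
  proof
    show "V \<inter> W = {}" if "V \<in> \<U> n" "W \<in> \<U> n" "V \<noteq> W" for V W n
      using that cells_disjoint unfolding \<U>_def by blast
    show "V \<subseteq> T \<or> V \<inter> T = {}" if "V \<in> \<U> n" "T \<in> upper_cuts" for V T n
      using that admissible_cells unfolding \<U>_def admissible_def by blast
    show "chosen V \<notin> W" if "V \<in> \<U> m" "W \<in> \<U> n" "m < n" for V W m n
      using chosen_avoids_later_cells that unfolding \<U>_def by blast
    show "(\<exists>T\<in>upper_cuts. x \<notin> T \<and> y \<in> T) \<or> (\<exists>n. \<exists>V\<in>\<U> n. \<forall>v\<in>V. x \<lessdot> v \<and> v \<lessdot> y)"
      if "x \<lessdot> y" for x y
      using cell_between[OF that _ D] unfolding \<U>_def by blast
    show "openin M (S V)" "openin M (K - S V)" if "V \<in> \<U> n" for V n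
      using that M_open unfolding \<G>_def by blast+
    show "openin M G" if "openin L G" for G
      using that M_open by blast
  qed (fact cell(1-3) S(1,2) K_M)+
  have gen: "M = topology_generated_by cs.generators"
    unfolding M_def cs.generators_def \<G>_def ..
  have card_cells: "|\<U> n| \<le>o |B|" for n
    using card_disjoint_open_le_base[OF B(1), of "\<U> n"] cell cells_disjoint unfolding \<U>_def by blast
  have "|S ` \<U> n \<union> (\<lambda>V. K - S V) ` \<U> n| \<le>o |B|" for n
  proof (rule card_of_Un_ordLeq_infinite_Field)
    show "infinite (Field |B| )"
      using B(2) unfolding Field_card_of .
    show "|S ` \<U> n| \<le>o |B|" "|(\<lambda>V. K - S V) ` \<U> n| \<le>o |B|"
      by (rule ordLeq_transitive[OF card_of_image card_cells])+
  qed (rule card_of_Card_order)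
  then have "|\<G>| \<le>o |B|"
    unfolding \<G>_def
    by (intro card_of_UNION_ordLeq_infinite[OF B(2) infinite_iff_card_of_nat[THEN iffD1, OF B(2)]]) blast
  then obtain B' where B': "is_base M B'" "|B'| \<le>o |B|"
    using base_of_generated[OF M_def B _ \<G>_sub] by blast
  have bij: "bij_betw f (topspace X) K" and cont: "continuous_map X L f"
    using f topspace_L unfolding continuous_bijection_def by simp_all
  have "continuous_map X M f"
    unfolding M_def
  proof (rule continuous_on_generated_topo)
    show "openin X (f -` U \<inter> topspace X)" if "U \<in> {G. openin L G} \<union> \<G>" for U
    proof -
      have "openin X {x \<in> topspace X. f x \<in> U}"
      proof (cases "openin L U")
        case True
        then show ?thesis by (rule openin_continuous_map_preimage[OF cont])
      next
        case False
        then show ?thesis using that S(3,4) unfolding \<G>_def by blast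
      qed
      moreover have "f -` U \<inter> topspace X = {x \<in> topspace X. f x \<in> U}"
        by blast
      ultimately show ?thesis by simp
    qed
    show "f ` topspace X \<subseteq> \<Union> ({G. openin L G} \<union> \<G>)"
      using bij K_M unfolding M_def bij_betw_def by simp
  qed
  then have "continuous_bijection X M f"
    unfolding continuous_bijection_def using bij K_M by simp
  moreover have "continuous_map M L id"
    unfolding continuous_map_def using K_M topspace_L M_open open_subset
    by (auto simp: Collect_conj_eq Int_absorb1)
  then have "continuous_bijection M L id"
    unfolding continuous_bijection_def using K_M topspace_L by simp
  ultimately show ?thesis
    using cs.GO_space_refined[OF gen haus] cs.dim_le_0_refined[OF gen] cs.Hausdorff_refined[OF gen haus] B'
    by blast
qed

end

theorem theorem3p3:
  fixes X :: "'a topology" and L :: "'b topology" and f :: "'a \<Rightarrow> 'b"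
  assumes "tychonoff_space X" and "zero_dimensional_space X"
    and "tychonoff_space L" and "class_L L"
    and "continuous_bijection X L f"
  shows "\<exists>(M :: 'b topology) (g :: 'a \<Rightarrow> 'b) (h :: 'b \<Rightarrow> 'b).
           tychonoff_space M \<and> zero_dimensional_space M \<and> GO_space M \<and>
           weight M \<le>o weight L \<and>
           continuous_bijection X M g \<and> continuous_bijection M L h \<and>
           (\<forall>x\<in>topspace X. f x = h (g x))"
proof -
  have GO: "GO_space L" and haus: "Hausdorff_space L"
    using assms(4) unfolding class_L_def GO_space_def by blast+
  have bij: "bij_betw f (topspace X) (topspace L)"
    using assms(5) unfolding continuous_bijection_def by blast
  have X: "X dim_le 0" and "topspace X \<noteq> {}"
    using assms(2) unfolding zero_dimensional_space_def by (auto simp flip: null_topspace_iff_trivial)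
  then have L_nonempty: "topspace L \<noteq> {}"
    using bij unfolding bij_betw_def by blast
  obtain B where B: "is_base L B" "weight L = |B|"
    using weight_base by blast
  have "\<exists>M. GO_space M \<and> M dim_le 0 \<and> Hausdorff_space M \<and> weight M \<le>o weight L \<and>
           continuous_bijection X M f \<and> continuous_bijection M L id"
  proof (cases "finite B")
    case True
    have "finite (topspace L)"
      by (rule finite_base_imp_finite[OF Hausdorff_imp_t1_space[OF haus] B(1) True])
    then have L: "L = discrete_topology (topspace L)"
      using haus by (intro finite_topspace_imp_discrete_topology) simp_all
    have clopen: "openin L U \<longleftrightarrow> U \<subseteq> topspace L" "closedin L U \<longleftrightarrow> U \<subseteq> topspace L" for U
      by (subst L, simp)+
    have "L dim_le 0"
      unfolding dimension_le_0_neighbourhood_base_of_clopen neighbourhood_base_of clopen by blast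
    moreover have "weight L \<le>o weight L"
      unfolding B(2) by (rule ordLeq_reflexive) (rule card_of_Well_order)
    moreover have "continuous_bijection L L id"
      unfolding continuous_bijection_def by simp
    ultimately show ?thesis
      using GO haus assms(5) by blast
  next
    case False
    obtain lt where "ordered_topology (topspace L) lt L"
      using GO_space_imp_ordered_topology[OF GO] .
    then interpret ordered_topology "topspace L" lt L .
    obtain \<D> where \<D>: "countable \<D>" "\<forall>D\<in>\<D>. subtopology L D = discrete_topology D"
      "L closure_of (\<Union>\<D>) = topspace L"
      using assms(4) unfolding class_L_def by blast
    define D where "D = from_nat_into (insert {} \<D>)"
    have range_D: "range D = insert {} \<D>"
      unfolding D_def using \<D>(1) by (intro range_from_nat_into) simp_all
    have D_discrete: "subtopology L (D n) = discrete_topology (D n)" for n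
    proof -
      have "D n \<in> insert {} \<D>"
        using range_D by blast
      then show ?thesis
        using \<D>(2) by auto
    qed
    have D_sub: "D n \<subseteq> topspace L" for n
      using arg_cong[OF D_discrete[of n], of topspace] by auto
    have "relatively_discrete L (D n)" for n
      unfolding relatively_discrete_def
    proof
      fix a assume "a \<in> D n"
      then have "openin (subtopology L (D n)) {a}"
        by (simp add: D_discrete)
      then show "\<exists>U. openin L U \<and> U \<inter> D n = {a}"
        unfolding openin_subtopology by metis
    qed
    moreover have "(\<Union>n. D n) = \<Union>\<D>"
      using range_D by auto
    ultimately obtain M B' where M: "GO_space M" "M dim_le 0" "Hausdorff_space M" "is_base M B'" "|B'| \<le>o |B|"
      "continuous_bijection X M f" "continuous_bijection M L id"
      using zero_dimensional_GO_refinement[OF X assms(5) haus, of D B] \<D>(3) D_sub B(1) False by metis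
    have "weight M \<le>o |B'|"
      using weight_base[of M] M(4) by blast
    then have "weight M \<le>o weight L"
      unfolding B(2) by (rule ordLeq_transitive[OF _ M(5)])
    then show ?thesis
      using M by blast
  qed
  then obtain M where M: "GO_space M" "M dim_le 0" "Hausdorff_space M" "weight M \<le>o weight L"
    "continuous_bijection X M f" "continuous_bijection M L id"
    by blast
  have "tychonoff_space M"
    unfolding tychonoff_space_def
    using Hausdorff_imp_t1_space[OF M(3)] zero_dimensional_imp_completely_regular_space[OF M(2)] by blast
  moreover have "topspace M \<noteq> {}"
    using M(6) L_nonempty unfolding continuous_bijection_def bij_betw_def by auto
  then have "zero_dimensional_space M"
    unfolding zero_dimensional_space_def using M(2) by (auto simp flip: null_topspace_iff_trivial)
  ultimately show ?thesis
    using M by (intro exI[of _ M] exI[of _ f] exI[of _ id]) simp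
qed

end
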